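(* Let $\mathbb{X}$ be a Banach space and let $A$ be the generator of a $\mathrm{C}_0$-semigroup $(T(t))_{t\ge 0}$ on $\mathbb{X}$ with $\|T(t)\|\le Me^{\omega_0 t}$ for all $t\ge 0$. For each $t\in\mathbb{R}$ let $B(t)\colon D(B(t))=D(A)\to\mathbb{X}$ be a linear operator. Assume that for each compact interval $[a,b]\subset\mathbb{R}$: (i) the mapping $B(\cdot)\colon[a,b]\to\mathcal{GL}_A(\mathbb{X})$ is (well defined and) continuous with respect to the norm $\|\cdot\|_A$; (ii) for every $\mu>\omega_0$ the mapping $t\mapsto B(t)R(\mu,A)$, $[a,b]\to\mathcal{L}(\mathbb{X})$, is continuously differentiable, and \[ \limsup_{\mu\to\infty}\ \sup_{t\in[a,b]}\left\|\frac{d}{dt}\big[B(t)R(\mu,A)\big]\right\|<\infty . \] Then the equation $u'(t)=(A+B(t))u(t)$ admits an evolution family $(U(t,s))_{t\ge s}$, $t,s\in\mathbb{R}$, on the whole real line.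
   Context: $\mathcal{L}(\mathbb{X})$ is the space of bounded linear operators on $\mathbb{X}$ with the operator norm, and $R(\mu,A)=(\mu I-A)^{-1}$ for $\mu\in\rho(A)$. With $A$, $M$, $\omega_0$ fixed as in the claim, $\mathcal{GL}_A(\mathbb{X})$ denotes the normed space of all linear operators $C$ in $\mathbb{X}$ with $D(C)=D(A)$ and \[ \|C\|_A:=\frac1M\sup_{\mu>\omega_0}\|(\mu-\omega_0)CR(\mu,A)\|<\infty . \] Write $A(s):=A+B(s)$ (with domain $D(A)$). On a compact interval $[a,b]$, the equation $u'(t)=(A+B(t))u(t)$ is said to admit an evolution family $(U(t,s))_{a\le s\le t\le b}$ if this is a family of bounded linear operators on $\mathbb{X}$ such that: (1) for each fixed $x\in\mathbb{X}$ the map $(t,s)\mapsto U(t,s)x$ is continuous on $\{a\le s\le t\le b\}$; $U(t,t)=I$; $U(t,s)U(s,r)=U(t,r)$ for $a\le r\le s\le t\le b$; and there are constants $M',\omega'$ with $\|U(t,s)\|\le M'e^{\omega'(t-s)}$ for $a\le s\le t\le b$; (2) for each $x\in D(A)$, $U(t,s)x$ is differentiable with respect to $t\ge s$, and \[ \frac{\partial^+U(t,s)}{\partial t}x\Big|_{t=s}=A(s)x,\qquad \frac{\partial U(t,s)}{\partial s}x=-U(t,s)A(s)x \quad (a\le s\le t\le b), \] where derivatives at endpoints are one-sided and $\partial^+/\partial t$ is the right derivative. The equation admits an evolution family on the whole real line if there is a family $(U(t,s))_{t\ge s}$, $t,s\in\mathbb{R}$, of bounded linear operators on $\mathbb{X}$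 whose restriction to $a\le s\le t\le b$ is an evolution family admitted by the equation on $[a,b]$, for every compact interval $[a,b]\subset\mathbb{R}$ (the constants $M',\omega'$ may depend on $[a,b]$). *)

theory Defs
  imports "HOL-Analysis.Analysis"
begin

text \<open>
  The class \<open>banach\<close> only provides real scalars. To cover real and complex Banach spaces at once,
  the scalar multiplication \<open>scl\<close> is a parameter: a \<open>real_normed_field\<close> is, up to isomorphism,
  the field of real or of complex numbers (Gelfand-Mazur), and \<open>scl = (*\<^sub>R)\<close> is the real case.
\<close>

definition banach_space_over :: "('k::real_normed_field \<Rightarrow> 'a::banach \<Rightarrow> 'a) \<Rightarrow> bool" where
  "banach_space_over scl \<longleftrightarrow>
     module scl \<and>
     (\<forall>r x. scl (of_real r) x = r *\<^sub>R x) \<and>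
     (\<forall>c x. norm (scl c x) = norm c * norm x)"

text \<open>
  \<open>'a \<Rightarrow>\<^sub>L 'a\<close> consists of the bounded real-linear operators; \<open>blinfun_over scl F\<close> says that \<open>F\<close> is
  linear over the given scalars.
\<close>

definition blinfun_over :: "('k::real_normed_field \<Rightarrow> 'a::banach \<Rightarrow> 'a) \<Rightarrow> ('a \<Rightarrow>\<^sub>L 'a) \<Rightarrow> bool" where
  "blinfun_over scl F \<longleftrightarrow> (\<forall>c x. blinfun_apply F (scl c x) = scl c (blinfun_apply F x))"


text \<open>
  An operator in \<open>'a\<close> with a domain that need not be all of \<open>'a\<close> is a partial map \<open>C :: 'a \<rightharpoonup> 'a\<close>;
  its domain is \<open>dom C\<close>.
\<close>

definition linear_operator :: "('k::real_normed_field \<Rightarrow> 'a::banach \<Rightarrow> 'a) \<Rightarrow> ('a \<rightharpoonup> 'a) \<Rightarrow> bool" where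
  "linear_operator scl C \<longleftrightarrow>
     module.subspace scl (dom C) \<and>
     (\<forall>x\<in>dom C. \<forall>y\<in>dom C. the (C (x + y)) = the (C x) + the (C y)) \<and>
     (\<forall>c. \<forall>x\<in>dom C. the (C (scl c x)) = scl c (the (C x)))"

definition op_add :: "('a::banach \<rightharpoonup> 'a) \<Rightarrow> ('a \<rightharpoonup> 'a) \<Rightarrow> ('a \<rightharpoonup> 'a)" where
  "op_add C E = (\<lambda>x. if x \<in> dom C \<inter> dom E then Some (the (C x) + the (E x)) else None)"

definition op_diff :: "('a::banach \<rightharpoonup> 'a) \<Rightarrow> ('a \<rightharpoonup> 'a) \<Rightarrow> ('a \<rightharpoonup> 'a)" where
  "op_diff C E = (\<lambda>x. if x \<in> dom C \<inter> dom E then Some (the (C x) - the (E x)) else None)"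

text \<open>Only the values \<open>T t\<close> with \<open>t \<ge> 0\<close> matter.\<close>

definition c0_semigroup ::
  "('k::real_normed_field \<Rightarrow> 'a::banach \<Rightarrow> 'a) \<Rightarrow> (real \<Rightarrow> 'a \<Rightarrow>\<^sub>L 'a) \<Rightarrow> bool" where
  "c0_semigroup scl T \<longleftrightarrow>
     (\<forall>t\<ge>0. blinfun_over scl (T t)) \<and>
     T 0 = id_blinfun \<and>
     (\<forall>t\<ge>0. \<forall>s\<ge>0. T (t + s) = T t o\<^sub>L T s) \<and>
     (\<forall>x. continuous_on {0..} (\<lambda>t. blinfun_apply (T t) x))"

definition generator :: "(real \<Rightarrow> 'a::banach \<Rightarrow>\<^sub>L 'a) \<Rightarrow> ('a \<rightharpoonup> 'a)" where
  "generator T = (\<lambda>x.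
     if \<exists>y. ((\<lambda>h. (1 / h) *\<^sub>R (blinfun_apply (T h) x - x)) \<longlongrightarrow> y) (at_right 0)
     then Some (Lim (at_right 0) (\<lambda>h. (1 / h) *\<^sub>R (blinfun_apply (T h) x - x)))
     else None)"

text \<open>
  \<open>R(\<mu>, A) = (\<mu> I - A)\<^sup>-\<^sup>1\<close>; meaningful only for \<open>\<mu>\<close> in the resolvent set of \<open>A\<close>. For the generator
  of a semigroup bounded by \<open>M exp (\<omega> t)\<close> this set contains every real \<open>\<mu> > \<omega>\<close>.
\<close>

definition resolvent :: "real \<Rightarrow> ('a::banach \<rightharpoonup> 'a) \<Rightarrow> ('a \<Rightarrow>\<^sub>L 'a)" where
  "resolvent \<mu> A = Blinfun (inv_into (dom A) (\<lambda>x. \<mu> *\<^sub>R x - the (A x)))"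

text \<open>
  \<open>C R(\<mu>, A)\<close> as an element of \<open>L(X)\<close>. \<open>Blinfun\<close> is unspecified on unbounded maps; boundedness
  of \<open>C R(\<mu>, A)\<close> is part of membership in \<open>GL_A\<close>.
\<close>

definition op_resolvent :: "('a::banach \<rightharpoonup> 'a) \<Rightarrow> real \<Rightarrow> ('a \<rightharpoonup> 'a) \<Rightarrow> ('a \<Rightarrow>\<^sub>L 'a)" where
  "op_resolvent C \<mu> A = Blinfun (\<lambda>x. the (C (blinfun_apply (resolvent \<mu> A) x)))"

definition GL ::
  "('k::real_normed_field \<Rightarrow> 'a::banach \<Rightarrow> 'a) \<Rightarrow> ('a \<rightharpoonup> 'a) \<Rightarrow> real \<Rightarrow> ('a \<rightharpoonup> 'a) set" where
  "GL scl A \<omega>\<^sub>0 =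
     {C. linear_operator scl C \<and> dom C = dom A \<and>
         (\<forall>\<mu>>\<omega>\<^sub>0. bounded_linear (\<lambda>x. the (C (blinfun_apply (resolvent \<mu> A) x)))) \<and>
         bdd_above ((\<lambda>\<mu>. norm ((\<mu> - \<omega>\<^sub>0) *\<^sub>R op_resolvent C \<mu> A)) ` {\<omega>\<^sub>0<..})}"

definition GL_norm :: "('a::banach \<rightharpoonup> 'a) \<Rightarrow> real \<Rightarrow> real \<Rightarrow> ('a \<rightharpoonup> 'a) \<Rightarrow> real" where
  "GL_norm A M \<omega>\<^sub>0 C = (1 / M) * (SUP \<mu>\<in>{\<omega>\<^sub>0<..}. norm ((\<mu> - \<omega>\<^sub>0) *\<^sub>R op_resolvent C \<mu> A))"

definition GL_continuous_on ::
  "('k::real_normed_field \<Rightarrow> 'a::banach \<Rightarrow> 'a) \<Rightarrow> ('a \<rightharpoonup> 'a) \<Rightarrow> real \<Rightarrow> real \<Rightarrow>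
    real set \<Rightarrow> (real \<Rightarrow> 'a \<rightharpoonup> 'a) \<Rightarrow> bool" where
  "GL_continuous_on scl A M \<omega>\<^sub>0 S B \<longleftrightarrow>
     (\<forall>t\<in>S. B t \<in> GL scl A \<omega>\<^sub>0) \<and>
     (\<forall>t\<in>S. ((\<lambda>s. GL_norm A M \<omega>\<^sub>0 (op_diff (B s) (B t))) \<longlongrightarrow> 0) (at t within S))"

text \<open>
  Unlike \<open>C1_differentiable_on\<close>, the derivatives at the endpoints of \<open>S = {a..b}\<close> are one-sided.
\<close>

definition C1_within :: "real set \<Rightarrow> (real \<Rightarrow> 'b::real_normed_vector) \<Rightarrow> bool" where
  "C1_within S f \<longleftrightarrow>
     (\<forall>t\<in>S. f differentiable (at t within S)) \<and>
     continuous_on S (\<lambda>t. vector_derivative f (at t within S))"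

text \<open>
  \<open>u' = \<A>(t) u\<close> with operators \<open>\<A> t\<close> of common domain \<open>D\<close> admits the evolution family \<open>U\<close> on
  \<open>{a..b}\<close>. Only the values \<open>U t s\<close> with \<open>a \<le> s \<le> t \<le> b\<close> matter. One-sided derivatives come from
  the restricted filters; on a one-point interval such a filter is trivial and the corresponding
  requirement is void, as is the right derivative in \<open>t\<close> at \<open>t = s = b\<close>.
\<close>

definition evolution_family_on ::
  "('k::real_normed_field \<Rightarrow> 'a::banach \<Rightarrow> 'a) \<Rightarrow> real \<Rightarrow> real \<Rightarrow>
    'a set \<Rightarrow> (real \<Rightarrow> 'a \<rightharpoonup> 'a) \<Rightarrow> (real \<Rightarrow> real \<Rightarrow> 'a \<Rightarrow>\<^sub>L 'a) \<Rightarrow> bool" where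
  "evolution_family_on scl a b D \<A> U \<longleftrightarrow>
     (\<forall>s t. a \<le> s \<and> s \<le> t \<and> t \<le> b \<longrightarrow> blinfun_over scl (U t s)) \<and>
     (\<forall>x. continuous_on {(t, s). a \<le> s \<and> s \<le> t \<and> t \<le> b} (\<lambda>(t, s). blinfun_apply (U t s) x)) \<and>
     (\<forall>t\<in>{a..b}. U t t = id_blinfun) \<and>
     (\<forall>r s t. a \<le> r \<and> r \<le> s \<and> s \<le> t \<and> t \<le> b \<longrightarrow> U t s o\<^sub>L U s r = U t r) \<and>
     (\<exists>M' \<omega>'. \<forall>s t. a \<le> s \<and> s \<le> t \<and> t \<le> b \<longrightarrow> norm (U t s) \<le> M' * exp (\<omega>' * (t - s))) \<and>
     (\<forall>x\<in>D. \<forall>s t. a \<le> s \<and> s \<le> t \<and> t \<le> b \<longrightarrow>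
        (\<lambda>\<tau>. blinfun_apply (U \<tau> s) x) differentiable (at t within {s..b})) \<and>
     (\<forall>x\<in>D. \<forall>s\<in>{a..b}.
        ((\<lambda>\<tau>. blinfun_apply (U \<tau> s) x) has_vector_derivative the (\<A> s x)) (at s within {s..b})) \<and>
     (\<forall>x\<in>D. \<forall>s t. a \<le> s \<and> s \<le> t \<and> t \<le> b \<longrightarrow>
        ((\<lambda>\<sigma>. blinfun_apply (U t \<sigma>) x) has_vector_derivative
           - blinfun_apply (U t s) (the (\<A> s x))) (at s within {a..t}))"

definition admits_evolution_family ::
  "('k::real_normed_field \<Rightarrow> 'a::banach \<Rightarrow> 'a) \<Rightarrow> 'a set \<Rightarrow> (real \<Rightarrow> 'a \<rightharpoonup> 'a) \<Rightarrow> bool" where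
  "admits_evolution_family scl D \<A> \<longleftrightarrow>
     (\<exists>U. \<forall>a b. a \<le> b \<longrightarrow> evolution_family_on scl a b D \<A> U)"

end

theory Submission
  imports Defs
begin

text \<open>
  Membership of \<open>B t\<close> in \<open>GL\<close> forces \<open>B t\<close> to be bounded on the domain of \<open>A\<close>: in
  \<open>B x = B R(\<mu>, A) (\<mu> x - A x)\<close> the factor \<open>1 / (\<mu> - \<omega>\<^sub>0)\<close> from the norm compensates \<open>\<mu> x\<close> as
  \<open>\<mu> \<rightarrow> \<infinity>\<close>. So \<open>B t\<close> extends to a bounded operator \<open>\<beta> t\<close>, and \<open>\<beta>\<close> is norm continuous. The Dyson
  series solves \<open>u(t) = T(t - s) x + \<integral> T(t - r) \<beta>(r) u(r) dr\<close>, which gives \<open>U(t, s)\<close>; the derivative in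
  \<open>s\<close> follows from the behaviour of \<open>U\<close> near the diagonal. For the derivative in \<open>t\<close>, continuous
  differentiability of \<open>\<beta>(t) R(\<mu>, A)\<close> is used: the expected derivative of \<open>u\<close> is constructed as the mild
  solution of the formally differentiated equation.
\<close>

section \<open>Strong continuity, increments and the Gronwall inequality\<close>

text \<open>The two time derivatives differ in difficulty. For the initial time, the cocycle law
  shifts the increment onto the fixed vector \<open>x\<close> of the domain, and norm continuity of
  the perturbation is enough. For the final time, U(t, s) x would have to lie in the domain of A
  again. A mild solution does not offer this, and the usual remedy, strong differentiability of the
  perturbation P, is not at hand: only P R is differentiable, R being the resolvent. With D the
  derivative of P R, the formal term P' u is D (\<mu> u - A u); replacing A u by u' - P u removes
  the unbounded operator. So the candidate for u' can be built before anything is known about the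
  regularity of u, and uniqueness identifies its integral with u. Times are coded as (initial time,
  elapsed time), which turns the triangle of admissible times into a product. Bounded operators here
  are real-linear by type; linearity over the given scalars is recovered from uniqueness of mild
  solutions.\<close>

text \<open>Split the value into \<open>F (f z) (g z - y0)\<close>, small by the local norm bound,
  and \<open>F (f z) y0\<close>, which converges by strong continuity.\<close>

lemma tendsto_strong_apply:
  fixes F :: "'t::topological_space \<Rightarrow> 'a::real_normed_vector \<Rightarrow>\<^sub>L 'b::real_normed_vector"
  assumes bd: "\<forall>\<^sub>F t in nhds t0. norm (F t) \<le> c"
    and sc: "((\<lambda>t. F t y0) \<longlongrightarrow> F t0 y0) (nhds t0)"
    and f: "(f \<longlongrightarrow> t0) G" and g: "(g \<longlongrightarrow> y0) G"
  shows "((\<lambda>z. F (f z) (g z)) \<longlongrightarrow> F t0 y0) G"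
proof -
  have ev: "\<forall>\<^sub>F z in G. norm (F (f z)) \<le> c"
    using filterlim_iff[THEN iffD1, rule_format, OF f bd] .
  have "((\<lambda>z. c * norm (g z - y0)) \<longlongrightarrow> c * norm (y0 - y0)) G"
    by (intro tendsto_intros g)
  then have lim0: "((\<lambda>z. c * norm (g z - y0)) \<longlongrightarrow> 0) G" by simp
  have "\<forall>\<^sub>F z in G. norm (F (f z) (g z - y0)) \<le> c * norm (g z - y0)"
    using ev by eventually_elim
      (meson norm_blinfun mult_right_mono norm_ge_zero order_trans)
  then have "((\<lambda>z. F (f z) (g z - y0)) \<longlongrightarrow> 0) G"
    by (rule Lim_null_comparison[OF _ lim0])
  moreover have "((\<lambda>z. F (f z) y0) \<longlongrightarrow> F t0 y0) G"
    using filterlim_compose[OF sc f] .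
  ultimately have "((\<lambda>z. F (f z) (g z - y0) + F (f z) y0) \<longlongrightarrow> 0 + F t0 y0) G"
    by (rule tendsto_add)
  then show ?thesis by (simp add: blinfun.diff_right)
qed

text \<open>The local norm bound is what upgrades pointwise continuity to joint continuity in
  parameter and vector. It is built in, so the uniform boundedness principle is not invoked.\<close>

definition strongly_cont ::
  "('t::topological_space \<Rightarrow> 'a::real_normed_vector \<Rightarrow>\<^sub>L 'b::real_normed_vector) \<Rightarrow> bool" where
  "strongly_cont F \<longleftrightarrow> (\<forall>x. continuous_on UNIV (\<lambda>t. F t x)) \<and>
     (\<forall>t. \<exists>c. \<forall>\<^sub>F s in nhds t. norm (F s) \<le> c)"

lemma strongly_cont_apply:
  assumes F: "strongly_cont F" and f: "continuous_on S f" and g: "continuous_on S g"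
  shows "continuous_on S (\<lambda>z. F (f z) (g z))"
  unfolding continuous_on_def
proof
  fix z assume z: "z \<in> S"
  obtain c where c: "\<forall>\<^sub>F s in nhds (f z). norm (F s) \<le> c"
    using F unfolding strongly_cont_def by blast
  have "continuous_on UNIV (\<lambda>t. F t (g z))" using F by (simp add: strongly_cont_def)
  then have "((\<lambda>t. F t (g z)) \<longlongrightarrow> F (f z) (g z)) (nhds (f z))"
    using tendsto_at_iff_tendsto_nhds[of "\<lambda>t. F t (g z)" "f z"] by (simp add: continuous_on_def)
  then show "((\<lambda>z. F (f z) (g z)) \<longlongrightarrow> F (f z) (g z)) (at z within S)"
    using tendsto_strong_apply[OF c] f g z unfolding continuous_on_def by blast
qed

text \<open>In \<open>k \<sigma> \<delta> r\<close>, \<open>\<sigma>\<close> is the left end of the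
  increment, \<open>\<delta>\<close> its length and \<open>r\<close> the integration variable. The
  integrand may change with the interval: joint continuity at \<open>(t, 0, 0)\<close> makes its
  mean tend to \<open>k t 0 0\<close>. The left end may itself move towards \<open>t\<close>, which
  covers increments on both sides of \<open>t\<close>.\<close>

lemma has_vector_derivative_from_increments:
  fixes F :: "real \<Rightarrow> 'a::banach" and k :: "real \<Rightarrow> real \<Rightarrow> real \<Rightarrow> 'a"
  assumes k: "continuous_on UNIV (\<lambda>z. k (fst z) (fst (snd z)) (snd (snd z)))"
    and inc: "\<And>\<sigma> \<tau>. a \<le> \<sigma> \<Longrightarrow> \<sigma> \<le> \<tau> \<Longrightarrow> \<tau> \<le> b \<Longrightarrow>
                F \<tau> - F \<sigma> = integral {0..\<tau> - \<sigma>} (k \<sigma> (\<tau> - \<sigma>))"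
    and t: "t \<in> {a..b}"
  shows "(F has_vector_derivative k t 0 0) (at t within {a..b})"
proof -
  have kr: "continuous_on {0..d} (k \<sigma> d')" for \<sigma> d d'
    using continuous_on_compose2[OF k, of "{0..d}" "\<lambda>r. (\<sigma>, d', r)"]
    by (simp add: continuous_intros)
  have main: "\<exists>d>0. \<forall>y\<in>{a..b}. norm (y - t) < d \<longrightarrow>
      norm (F y - F t - (y - t) *\<^sub>R k t 0 0) \<le> e * norm (y - t)" if e: "e > 0" for e
  proof -
    have "isCont (\<lambda>z. k (fst z) (fst (snd z)) (snd (snd z))) (t, 0, 0)"
      using k by (simp add: continuous_on_eq_continuous_at)
    then obtain d where d: "d > 0" and near: "\<And>z. dist z (t, 0, 0) < d \<Longrightarrow>
        dist (k (fst z) (fst (snd z)) (snd (snd z))) (k t 0 0) < e"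
      unfolding continuous_at_eps_delta using e by (metis fst_conv snd_conv)
    \<comment> \<open>Thirds, because the norm of a triple is at most the sum of its three
      coordinate norms.\<close>
    have near': "norm (k \<sigma> \<delta> r - k t 0 0) \<le> e"
      if "\<bar>\<sigma> - t\<bar> < d/3" "\<bar>\<delta>\<bar> < d/3" "\<bar>r\<bar> < d/3" for \<sigma> \<delta> r
    proof -
      have "norm ((\<sigma> - t, \<delta>, r)) \<le> norm (\<sigma> - t) + (norm \<delta> + norm r)"
        using norm_Pair_le[of "\<sigma> - t" "(\<delta>, r)"] norm_Pair_le[of \<delta> r] by linarith
      then have "dist (\<sigma>, \<delta>, r) (t, 0, 0) < d"
        using that by (simp add: dist_norm)
      from near[OF this] show ?thesis by (simp add: dist_norm)
    qed
    have key: "norm (F \<tau> - F \<sigma> - (\<tau> - \<sigma>) *\<^sub>R k t 0 0) \<le> e * (\<tau> - \<sigma>)"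
      if "a \<le> \<sigma>" "\<sigma> \<le> \<tau>" "\<tau> \<le> b" "\<bar>\<sigma> - t\<bar> < d/3" "\<tau> - \<sigma> < d/3" for \<sigma> \<tau>
    proof -
      have "F \<tau> - F \<sigma> - (\<tau> - \<sigma>) *\<^sub>R k t 0 0 =
          integral {0..\<tau> - \<sigma>} (k \<sigma> (\<tau> - \<sigma>)) - integral {0..\<tau> - \<sigma>} (\<lambda>_. k t 0 0)"
        using that inc[of \<sigma> \<tau>] by simp
      also have "\<dots> = integral {0..\<tau> - \<sigma>} (\<lambda>r. k \<sigma> (\<tau> - \<sigma>) r - k t 0 0)"
        by (rule integral_diff[symmetric]) (auto intro: integrable_continuous_real kr)
      also have "norm \<dots> \<le> e * ((\<tau> - \<sigma>) - 0)"
        by (rule integral_bound) (use that kr in \<open>auto intro!: near' continuous_intros\<close>)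
      finally show ?thesis by simp
    qed
    show ?thesis
    proof (intro exI[of _ "d/3"] conjI ballI impI)
      fix y assume y: "y \<in> {a..b}" "norm (y - t) < d/3"
      show "norm (F y - F t - (y - t) *\<^sub>R k t 0 0) \<le> e * norm (y - t)"
      proof (cases "t \<le> y")
        case True
        then show ?thesis using key[of t y] y t d by auto
      next
        case False
        then have "norm (F t - F y - (t - y) *\<^sub>R k t 0 0) \<le> e * (t - y)"
          using key[of y t] y t d by auto
        moreover have "F y - F t - (y - t) *\<^sub>R k t 0 0 = - (F t - F y - (t - y) *\<^sub>R k t 0 0)"
          by (simp add: algebra_simps)
        ultimately show ?thesis using False by (metis norm_minus_cancel real_norm_def abs_minus_commute abs_of_pos diff_gt_0_iff_gt not_le)
      qed
    qed (use d in simp)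
  qed
  show ?thesis
    unfolding has_vector_derivative_def has_derivative_within_alt
    using main by (auto intro: bounded_linear_intros)
qed

text \<open>Integrating factor: with \<open>G\<close> the primitive of \<open>g\<close>, the
  function \<open>exp (- L * x) * G x\<close> starts at \<open>0\<close> and has nonpositive
  derivative. So \<open>G\<close> is nonpositive, and the assumed inequality passes this on to
  \<open>g\<close>.\<close>

lemma gronwall_zero:
  fixes g :: "real \<Rightarrow> real"
  assumes g: "continuous_on {0..N} g"
    and le: "\<And>\<tau>. \<tau> \<in> {0..N} \<Longrightarrow> g \<tau> \<le> L * integral {0..\<tau>} g"
    and L: "L \<ge> 0" and \<tau>: "\<tau> \<in> {0..N}"
  shows "g \<tau> \<le> 0"
proof -
  define G where "G = (\<lambda>\<tau>. integral {0..\<tau>} g)"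
  have G: "(G has_real_derivative g x) (at x within {0..N})" if "x \<in> {0..N}" for x
    unfolding G_def has_real_derivative_iff_has_vector_derivative
    by (rule integral_has_vector_derivative[OF g that])
  have der: "((\<lambda>x. exp (- L * x) * G x) has_real_derivative
        exp (- L * x) * (g x - L * G x)) (at x within {0..N})" if "x \<in> {0..N}" for x
  proof -
    have "((\<lambda>x. exp (- L * x) * G x) has_real_derivative
        exp (- L * x) * (- L) * G x + g x * exp (- L * x)) (at x within {0..N})"
      by (auto intro!: derivative_eq_intros G that)
    moreover have "exp (- L * x) * (- L) * G x + g x * exp (- L * x) = exp (- L * x) * (g x - L * G x)"
      by (simp add: algebra_simps)
    ultimately show ?thesis by simp
  qed
  have "exp (- L * \<tau>) * G \<tau> \<le> exp (- L * 0) * G 0"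
  proof (rule DERIV_nonpos_imp_decreasing_open[where f = "\<lambda>x. exp (- L * x) * G x"])
    fix x assume x: "0 < x" "x < \<tau>"
    then have "((\<lambda>x. exp (- L * x) * G x) has_real_derivative
        exp (- L * x) * (g x - L * G x)) (at x)"
      using der[of x] \<tau> at_within_Icc_at[of 0 x N] by auto
    moreover have "exp (- L * x) * (g x - L * G x) \<le> 0"
      using le[of x] x \<tau> by (simp add: G_def mult_le_0_iff)
    ultimately show "\<exists>y. ((\<lambda>x. exp (- L * x) * G x) has_real_derivative y) (at x) \<and> y \<le> 0"
      by blast
  next
    have "continuous_on {0..N} (\<lambda>x. exp (- L * x) * G x)"
      using der by (rule DERIV_continuous_on)
    then show "continuous_on {0..\<tau>} (\<lambda>x. exp (- L * x) * G x)"
      by (rule continuous_on_subset) (use \<tau> in auto)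
  qed (use \<tau> in auto)
  then have "G \<tau> \<le> 0" by (simp add: G_def mult_le_0_iff)
  then show ?thesis using le[OF \<tau>] L unfolding G_def
    by (meson mult_nonneg_nonpos order_trans)
qed

section \<open>Strongly continuous semigroups and their resolvents\<close>

lemma right_difference_quotient:
  fixes F :: "real \<Rightarrow> 'a::real_normed_vector"
  assumes F: "(F has_vector_derivative y) (at t within {t..b})" and "t < b"
  shows "((\<lambda>h. (1 / h) *\<^sub>R (F (t + h) - F t)) \<longlongrightarrow> y) (at_right 0)"
proof -
  have "((\<lambda>u. (1 / norm (u - t)) *\<^sub>R (F u - (F t + (u - t) *\<^sub>R y))) \<longlongrightarrow> 0) (at_right t)"
    using F \<open>t < b\<close> unfolding has_vector_derivative_def has_derivative_within
    by (simp add: at_within_Icc_at_right)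
  then have "((\<lambda>h. (1 / norm h) *\<^sub>R (F (h + t) - (F t + h *\<^sub>R y))) \<longlongrightarrow> 0) (at_right 0)"
    unfolding at_right_to_0[of t] filterlim_filtermap by simp
  then have "((\<lambda>h. (1 / norm h) *\<^sub>R (F (h + t) - (F t + h *\<^sub>R y)) + y) \<longlongrightarrow> 0 + y) (at_right 0)"
    by (intro tendsto_add tendsto_const)
  then have "((\<lambda>h. (1 / norm h) *\<^sub>R (F (h + t) - (F t + h *\<^sub>R y)) + y) \<longlongrightarrow> y) (at_right 0)"
    by simp
  moreover have "\<forall>\<^sub>F h in at_right 0. (1 / norm h) *\<^sub>R (F (h + t) - (F t + h *\<^sub>R y)) + y =
      (1 / h) *\<^sub>R (F (t + h) - F t)"
    using eventually_at_right_less[of "0::real"]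
    by eventually_elim (simp add: algebra_simps)
  ultimately show ?thesis using tendsto_cong by fastforce
qed

locale strongly_continuous_semigroup =
  fixes T :: "real \<Rightarrow> 'a::banach \<Rightarrow>\<^sub>L 'a" and M \<omega> :: real
  assumes T_0: "T 0 = id_blinfun"
    and T_add: "\<And>t s. t \<ge> 0 \<Longrightarrow> s \<ge> 0 \<Longrightarrow> T (t + s) = T t o\<^sub>L T s"
    and T_cont: "\<And>x. continuous_on {0..} (\<lambda>t. T t x)"
    and T_bound: "\<And>t. t \<ge> 0 \<Longrightarrow> norm (T t) \<le> M * exp (\<omega> * t)"
begin

text \<open>
  Extending \<open>T\<close> by the identity to negative times makes all integrands below continuous on whole
  spaces, so that continuity needs no domain conditions.
\<close>

definition Tp :: "real \<Rightarrow> 'a \<Rightarrow>\<^sub>L 'a" where "Tp t = T (max 0 t)"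

lemma Tp_eq [simp]: "t \<ge> 0 \<Longrightarrow> Tp t = T t"
  by (simp add: Tp_def max_def)

text \<open>The maximum with \<open>0\<close> and the absolute value make the bound monotone in
  \<open>N\<close> whatever the signs of \<open>M\<close> and \<open>\<omega>\<close>.\<close>

lemma Tp_bound:
  assumes "\<bar>t\<bar> \<le> N"
  shows "norm (Tp t) \<le> max 0 M * exp (\<bar>\<omega>\<bar> * N)"
proof -
  have "norm (Tp t) \<le> M * exp (\<omega> * max 0 t)"
    unfolding Tp_def by (rule T_bound) simp
  also have "\<dots> \<le> max 0 M * exp (\<bar>\<omega>\<bar> * N)"
  proof (rule mult_mono)
    have "\<omega> * max 0 t \<le> \<bar>\<omega>\<bar> * \<bar>t\<bar>"
      by (cases "t \<ge> 0") (auto simp: max_def intro: mult_right_mono mult_nonneg_nonpos)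
    also have "\<dots> \<le> \<bar>\<omega>\<bar> * N" using assms by (intro mult_left_mono) auto
    finally show "exp (\<omega> * max 0 t) \<le> exp (\<bar>\<omega>\<bar> * N)" by simp
  qed auto
  finally show ?thesis .
qed

lemma strongly_cont_Tp: "strongly_cont Tp"
  unfolding strongly_cont_def
proof (intro conjI allI)
  show "continuous_on UNIV (\<lambda>t. Tp t x)" for x
    unfolding Tp_def by (rule continuous_on_compose2[OF T_cont]) (auto intro: continuous_intros)
  fix t :: real
  have "\<forall>\<^sub>F s in nhds t. s \<in> ball t 1" by (rule eventually_nhds_in_open) auto
  then have "\<forall>\<^sub>F s in nhds t. norm (Tp s) \<le> max 0 M * exp (\<bar>\<omega>\<bar> * (\<bar>t\<bar> + 1))"
    by eventually_elim (rule Tp_bound, auto simp: dist_real_def)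
  then show "\<exists>c. \<forall>\<^sub>F s in nhds t. norm (Tp s) \<le> c" by blast
qed

lemmas Tp_apply_cont [continuous_intros] = strongly_cont_apply[OF strongly_cont_Tp]

section \<open>The generator and the integrated semigroup\<close>

text \<open>The graph of the generator as a relation: membership in the domain and the value come
  together, without partial maps. \<open>gen_iff_generator\<close> links it to
  \<open>generator\<close>.\<close>

definition gen :: "'a \<Rightarrow> 'a \<Rightarrow> bool" where
  "gen x y \<longleftrightarrow> ((\<lambda>h. (1 / h) *\<^sub>R (T h x - x)) \<longlongrightarrow> y) (at_right 0)"

lemma gen_unique: "gen x y \<Longrightarrow> gen x y' \<Longrightarrow> y = y'"
  unfolding gen_def by (rule tendsto_unique[OF trivial_limit_at_right_real])

text \<open>The semigroup is only strongly continuous, so the integral is taken vector by vector and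
  then packed as an operator.\<close>

definition intT :: "real \<Rightarrow> 'a \<Rightarrow>\<^sub>L 'a" where
  "intT t = Blinfun (\<lambda>x. integral {0..t} (\<lambda>r. Tp r x))"

lemma Tp_integrable [simp]: "(\<lambda>r. Tp r x) integrable_on {a..b}"
  by (intro integrable_continuous_real continuous_intros)

lemma intT_apply: "intT t x = integral {0..t} (\<lambda>r. Tp r x)"
proof -
  have "bounded_linear (\<lambda>x. integral {0..t} (\<lambda>r. Tp r x))"
  proof (cases "t \<ge> 0")
    case True
    show ?thesis
    proof (rule bounded_linear_intro)
      fix x y :: 'a and c :: real
      show "integral {0..t} (\<lambda>r. Tp r (x + y)) = integral {0..t} (\<lambda>r. Tp r x) + integral {0..t} (\<lambda>r. Tp r y)"
        by (simp add: blinfun.add_right integral_add)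
      show "integral {0..t} (\<lambda>r. Tp r (c *\<^sub>R x)) = c *\<^sub>R integral {0..t} (\<lambda>r. Tp r x)"
        by (simp add: blinfun.scaleR_right)
      have "norm (integral {0..t} (\<lambda>r. Tp r x)) \<le> (max 0 M * exp (\<bar>\<omega>\<bar> * t) * norm x) * (t - 0)"
      proof (rule integral_bound)
        fix r assume "r \<in> {0..t}"
        then have "norm (Tp r) \<le> max 0 M * exp (\<bar>\<omega>\<bar> * t)" by (intro Tp_bound) auto
        then show "norm (Tp r x) \<le> max 0 M * exp (\<bar>\<omega>\<bar> * t) * norm x"
          by (meson norm_blinfun mult_right_mono norm_ge_zero order_trans)
      qed (use True in \<open>auto intro!: continuous_intros\<close>)
      then show "norm (integral {0..t} (\<lambda>r. Tp r x)) \<le> norm x * (max 0 M * exp (\<bar>\<omega>\<bar> * t) * t)"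
        by (simp add: mult_ac)
    qed
  qed (simp add: bounded_linear_zero)
  then show ?thesis by (simp add: intT_def bounded_linear_Blinfun_apply)
qed

lemma T_intT:
  assumes "t \<ge> 0" "h \<ge> 0"
  shows "T h (intT t x) = intT (h + t) x - intT h x"
proof -
  have "T h (intT t x) = integral {0..t} (\<lambda>r. T h (Tp r x))"
    unfolding intT_apply
    using integral_linear[OF Tp_integrable[of x 0 t] blinfun.bounded_linear_right[of "T h"]]
    by (simp add: o_def)
  also have "\<dots> = integral {0..t} (\<lambda>r. Tp (r + h) x)"
    using assms by (intro integral_cong) (auto simp: T_add add.commute[of _ h])
  also have "\<dots> = integral {h..h + t} (\<lambda>r. Tp r x)"
    using integral_shift_real_ivl[of h h "h + t" "\<lambda>r. Tp r x"] by simp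
  also have "\<dots> = intT (h + t) x - intT h x"
    using Henstock_Kurzweil_Integration.integral_combine[of 0 h "h + t" "\<lambda>r. Tp r x"] assms
    by (simp add: intT_apply algebra_simps)
  finally show ?thesis .
qed

lemma intT_T:
  assumes "t \<ge> 0" "h \<ge> 0"
  shows "intT t (T h x) = T h (intT t x)"
proof -
  have "T h (intT t x) = integral {0..t} (\<lambda>r. T h (Tp r x))"
    unfolding intT_apply
    using integral_linear[OF Tp_integrable[of x 0 t] blinfun.bounded_linear_right[of "T h"]]
    by (simp add: o_def)
  also have "T h (Tp r x) = Tp r (T h x)" if "r \<in> {0..t}" for r
    using T_add[of h r] T_add[of r h] that assms
    by (simp add: add.commute) (metis blinfun_apply_blinfun_compose)
  then have "integral {0..t} (\<lambda>r. T h (Tp r x)) = intT t (T h x)"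
    unfolding intT_apply by (intro integral_cong) auto
  finally show ?thesis by simp
qed

lemma intT_right_derivative:
  assumes "t \<ge> 0"
  shows "((\<lambda>h. (1 / h) *\<^sub>R (intT (t + h) x - intT t x)) \<longlongrightarrow> T t x) (at_right 0)"
proof (rule right_difference_quotient)
  have "((\<lambda>u. intT u x) has_vector_derivative Tp t x) (at t within {0..t + 1})"
    unfolding intT_apply
    by (rule integral_has_vector_derivative) (use assms in \<open>auto intro!: continuous_intros\<close>)
  then show "((\<lambda>u. intT u x) has_vector_derivative T t x) (at t within {t..t + 1})"
    using assms by (auto elim!: has_vector_derivative_within_subset)
qed simp

lemma intT_quotient: "((\<lambda>h. (1 / h) *\<^sub>R intT h x) \<longlongrightarrow> x) (at_right 0)"
  using intT_right_derivative[of 0 x] by (simp add: T_0 intT_apply[of 0])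

text \<open>By \<open>T_intT\<close> the difference quotient is that of \<open>intT\<close> at
  \<open>t\<close> minus that of \<open>intT\<close> at \<open>0\<close>.\<close>

lemma gen_intT:
  assumes "t \<ge> 0"
  shows "gen (intT t x) (T t x - x)"
proof -
  have "((\<lambda>h. (1 / h) *\<^sub>R (intT (t + h) x - intT t x) - (1 / h) *\<^sub>R intT h x) \<longlongrightarrow> T t x - x) (at_right 0)"
    by (intro tendsto_diff intT_right_derivative intT_quotient assms)
  moreover have "\<forall>\<^sub>F h in at_right 0. (1 / h) *\<^sub>R (intT (t + h) x - intT t x) - (1 / h) *\<^sub>R intT h x =
      (1 / h) *\<^sub>R (T h (intT t x) - intT t x)"
    using eventually_at_right_less[of "0::real"]
    by eventually_elim (simp add: T_intT assms algebra_simps)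
  ultimately show ?thesis unfolding gen_def using tendsto_cong by fastforce
qed

text \<open>Compute the generator at \<open>intT t x\<close> twice: \<open>gen_intT\<close> gives
  the left side; commuting \<open>intT t\<close> with the difference quotients of \<open>x\<close>
  gives the right side.\<close>

lemma gen_imp_T_diff:
  assumes g: "gen x y" and t: "t \<ge> 0"
  shows "T t x - x = intT t y"
proof -
  have "((\<lambda>h. intT t ((1 / h) *\<^sub>R (T h x - x))) \<longlongrightarrow> intT t y) (at_right 0)"
    using g unfolding gen_def by (intro blinfun.tendsto tendsto_const)
  moreover have "\<forall>\<^sub>F h in at_right 0. intT t ((1 / h) *\<^sub>R (T h x - x)) = (1 / h) *\<^sub>R (T h (intT t x) - intT t x)"
    using eventually_at_right_less[of "0::real"]
    by eventually_elim (simp add: blinfun.scaleR_right blinfun.diff_right intT_T t)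
  ultimately have "gen (intT t x) (intT t y)" unfolding gen_def using tendsto_cong by fastforce
  then show ?thesis using gen_unique gen_intT[OF t] by blast
qed

lemma gen_T:
  assumes g: "gen x y" and t: "t \<ge> 0"
  shows "gen (T t x) (T t y)"
proof -
  have "((\<lambda>h. T t ((1 / h) *\<^sub>R (T h x - x))) \<longlongrightarrow> T t y) (at_right 0)"
    using g unfolding gen_def by (intro blinfun.tendsto tendsto_const)
  moreover have "\<forall>\<^sub>F h in at_right 0. T t ((1 / h) *\<^sub>R (T h x - x)) = (1 / h) *\<^sub>R (T h (T t x) - T t x)"
    using eventually_at_right_less[of "0::real"]
  proof eventually_elim
    case (elim h)
    then have "T t (T h x) = T h (T t x)"
      using T_add[of t h] T_add[of h t] t
      by (simp add: add.commute) (metis blinfun_apply_blinfun_compose)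
    then show ?case by (simp add: blinfun.scaleR_right blinfun.diff_right)
  qed
  ultimately show ?thesis unfolding gen_def using tendsto_cong by fastforce
qed

section \<open>Existence of the resolvent\<close>

text \<open>The two conjuncts are the right and the left inverse property with respect to \<mu> - A;
  the first also places the range of \<open>R\<close> in the domain of A.\<close>

definition is_resolvent :: "real \<Rightarrow> ('a \<Rightarrow>\<^sub>L 'a) \<Rightarrow> bool" where
  "is_resolvent \<mu> R \<longleftrightarrow> (\<forall>x. gen (R x) (\<mu> *\<^sub>R R x - x)) \<and> (\<forall>x y. gen x y \<longrightarrow> R (\<mu> *\<^sub>R x - y) = x)"

lemma is_resolvent_T:
  assumes R: "is_resolvent \<mu> R" and t: "t \<ge> 0"
  shows "R (T t x) = T t (R x)"
proof -
  have "gen (T t (R x)) (T t (\<mu> *\<^sub>R R x - x))" using R t by (intro gen_T) (auto simp: is_resolvent_def)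
  then have "R (\<mu> *\<^sub>R T t (R x) - T t (\<mu> *\<^sub>R R x - x)) = T t (R x)" using R by (auto simp: is_resolvent_def)
  then show ?thesis by (simp add: blinfun.diff_right blinfun.scaleR_right)
qed

lemma gen_scaleR: "gen x y \<Longrightarrow> gen (c *\<^sub>R x) (c *\<^sub>R y)"
  unfolding gen_def
proof -
  assume "((\<lambda>h. (1 / h) *\<^sub>R (T h x - x)) \<longlongrightarrow> y) (at_right 0)"
  then have "((\<lambda>h. c *\<^sub>R (1 / h) *\<^sub>R (T h x - x)) \<longlongrightarrow> c *\<^sub>R y) (at_right 0)"
    by (intro tendsto_scaleR tendsto_const)
  moreover have "c *\<^sub>R (1 / h) *\<^sub>R (T h x - x) = (1 / h) *\<^sub>R (T h (c *\<^sub>R x) - c *\<^sub>R x)" for h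
    by (simp add: blinfun.scaleR_right scaleR_diff_right)
  ultimately show "((\<lambda>h. (1 / h) *\<^sub>R (T h (c *\<^sub>R x) - c *\<^sub>R x)) \<longlongrightarrow> c *\<^sub>R y) (at_right 0)"
    by simp
qed

text \<open>The averages \<open>(1 / h) *\<^sub>R intT h x\<close> lie in the domain by
  \<open>gen_intT\<close> and tend to \<open>x\<close>.\<close>

lemma gen_dense: "closure {x. \<exists>y. gen x y} = UNIV"
proof (intro equalityI subsetI UNIV_I)
  fix x
  have "\<forall>\<^sub>F h in at_right 0. (1 / h) *\<^sub>R intT h x \<in> closure {x. \<exists>y. gen x y}"
    using eventually_at_right_less[of "0::real"]
  proof eventually_elim
    case (elim h)
    have "gen ((1 / h) *\<^sub>R intT h x) ((1 / h) *\<^sub>R (T h x - x))"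
      using elim by (intro gen_scaleR gen_intT) simp
    then show ?case using closure_subset[of "{x. \<exists>y. gen x y}"] by auto
  qed
  then show "x \<in> closure {x. \<exists>y. gen x y}"
    by (rule Lim_in_closed_set[OF closed_closure _ _ intT_quotient]) simp
qed

text \<open>
  \<open>R\<close> is the negative inverse of the generator, the limit of \<open>intT n\<close>; here \<open>intT n\<close> is a partial
  sum of \<open>\<Sum>k. T k o\<^sub>L intT 1\<close>, which converges in operator norm.
\<close>

lemma resolvent_exists_neg:
  assumes "\<omega> < 0"
  shows "\<exists>R :: 'a \<Rightarrow>\<^sub>L 'a. (\<forall>x. gen (R x) (- x)) \<and> (\<forall>x y. gen x y \<longrightarrow> R y = - x)"
proof -
  have "summable (\<lambda>n. T (real n) o\<^sub>L intT 1)"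
  proof (rule summable_comparison_test')
    show "summable (\<lambda>n. M * norm (intT 1) * exp \<omega> ^ n)"
      using assms by (intro summable_mult summable_geometric) auto
    fix n :: nat
    have "norm (T (real n) o\<^sub>L intT 1) \<le> norm (T (real n)) * norm (intT 1)"
      by (rule norm_blinfun_compose)
    also have "\<dots> \<le> M * exp (\<omega> * real n) * norm (intT 1)"
      by (intro mult_right_mono T_bound) auto
    finally show "norm (T (real n) o\<^sub>L intT 1) \<le> M * norm (intT 1) * exp \<omega> ^ n"
      by (simp add: exp_of_nat2_mult mult_ac)
  qed
  then have sums: "(\<lambda>n. T (real n) o\<^sub>L intT 1) sums (\<Sum>n. T (real n) o\<^sub>L intT 1)"
    by (rule summable_sums)
  define R where "R = (\<Sum>n. T (real n) o\<^sub>L intT 1)"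
  have part: "(\<Sum>k<n. T (real k) (intT 1 x)) = intT (real n) x" for n x
    by (induction n) (simp_all add: T_intT intT_apply[of 0] add.commute)
  have lim: "(\<lambda>n. intT (real n) x) \<longlonglongrightarrow> R x" for x
  proof -
    have "(\<lambda>n. blinfun_apply (\<Sum>k<n. T (real k) o\<^sub>L intT 1) x) \<longlonglongrightarrow> R x"
      using sums unfolding sums_def R_def by (intro blinfun.tendsto tendsto_const)
    then show ?thesis by (simp add: blinfun.sum_left part)
  qed
  have T_null: "(\<lambda>n. T (real n) z) \<longlonglongrightarrow> 0" for z
  proof (rule Lim_null_comparison)
    show "\<forall>\<^sub>F n in sequentially. norm (T (real n) z) \<le> M * norm z * exp \<omega> ^ n"
    proof (rule always_eventually, rule allI)
      fix n :: nat
      have "norm (T (real n) z) \<le> norm (T (real n)) * norm z" by (rule norm_blinfun)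
      also have "\<dots> \<le> M * exp (\<omega> * real n) * norm z" by (intro mult_right_mono T_bound) auto
      finally show "norm (T (real n) z) \<le> M * norm z * exp \<omega> ^ n"
        by (simp add: exp_of_nat2_mult mult_ac)
    qed
    show "(\<lambda>n. M * norm z * exp \<omega> ^ n) \<longlonglongrightarrow> 0"
      using assms by (intro tendsto_mult_right_zero LIMSEQ_power_zero) auto
  qed
  have TR: "T h (R x) - R x = - intT h x" if "h \<ge> 0" for h x
  proof -
    have "(\<lambda>n. T h (intT (real n) x)) \<longlonglongrightarrow> T h (R x)"
      by (intro blinfun.tendsto tendsto_const lim)
    \<comment> \<open>\<open>T_intT\<close> is used in both orders: either product involves the
      integral up to \<open>n + h\<close>. The term with \<open>T (real n)\<close> vanishes in the
      limit because \<open>\<omega>\<close> is negative.\<close>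
    moreover have "T h (intT (real n) x) = intT (real n) x + T (real n) (intT h x) - intT h x" for n
      using that by (simp add: T_intT add.commute)
    moreover have "(\<lambda>n. intT (real n) x + T (real n) (intT h x) - intT h x) \<longlonglongrightarrow> R x + 0 - intT h x"
      by (intro tendsto_intros lim T_null)
    ultimately have "T h (R x) = R x + 0 - intT h x" using LIMSEQ_unique by simp
    then show ?thesis by simp
  qed
  have "gen (R x) (- x)" for x
  proof -
    have "((\<lambda>h. - ((1 / h) *\<^sub>R intT h x)) \<longlongrightarrow> - x) (at_right 0)"
      by (intro tendsto_minus intT_quotient)
    moreover have "\<forall>\<^sub>F h in at_right 0. - ((1 / h) *\<^sub>R intT h x) = (1 / h) *\<^sub>R (T h (R x) - R x)"
      using eventually_at_right_less[of "0::real"]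
      by eventually_elim (simp add: TR)
    ultimately show ?thesis unfolding gen_def using tendsto_cong by fastforce
  qed
  moreover have "R y = - x" if "gen x y" for x y
  proof -
    have "(\<lambda>n. T (real n) x - x) \<longlonglongrightarrow> 0 - x" by (intro tendsto_intros T_null)
    moreover have "T (real n) x - x = intT (real n) y" for n using gen_imp_T_diff[OF that] by simp
    ultimately show ?thesis using LIMSEQ_unique[OF lim[of y]] by simp
  qed
  ultimately show ?thesis by blast
qed

end

text \<open>The rescaled semigroup \<open>exp (- \<mu> * t) *\<^sub>R T t\<close> has negative
  growth bound \<open>\<omega> - \<mu>\<close> and generator A - \<mu>, whose negative inverse is
  the resolvent. The generator has to be transferred in both directions, one for each inverse
  identity.\<close>

lemma (in strongly_continuous_semigroup) resolvent_exists:
  assumes \<mu>: "\<mu> > \<omega>"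
  shows "\<exists>R. is_resolvent \<mu> R"
proof -
  define S where "S = (\<lambda>t. exp (- \<mu> * t) *\<^sub>R T t)"
  interpret S: strongly_continuous_semigroup S M "\<omega> - \<mu>"
  proof
    show "S 0 = id_blinfun" by (simp add: S_def T_0)
    show "S (t + s) = S t o\<^sub>L S s" if "t \<ge> 0" "s \<ge> 0" for t s
      using that by (simp add: S_def T_add bounded_bilinear.scaleR_left[OF bounded_bilinear_blinfun_compose]
          bounded_bilinear.scaleR_right[OF bounded_bilinear_blinfun_compose] mult_exp_exp distrib_left)
    show "continuous_on {0..} (\<lambda>t. S t x)" for x
      unfolding S_def blinfun.scaleR_left by (intro continuous_intros T_cont)
    show "norm (S t) \<le> M * exp ((\<omega> - \<mu>) * t)" if "t \<ge> 0" for t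
    proof -
      have "norm (S t) = exp (- \<mu> * t) * norm (T t)" by (simp add: S_def)
      also have "\<dots> \<le> exp (- \<mu> * t) * (M * exp (\<omega> * t))" by (intro mult_left_mono T_bound that) auto
      also have "\<dots> = M * exp ((\<omega> - \<mu>) * t)" by (simp add: mult_exp_exp left_diff_distrib)
      finally show ?thesis .
    qed
  qed
  have "((\<lambda>h. exp (- \<mu> * h)) has_real_derivative - \<mu>) (at 0)"
    by (auto intro!: derivative_eq_intros)
  then have "((\<lambda>h. (exp (- \<mu> * h) - 1) / h) \<longlongrightarrow> - \<mu>) (at 0)"
    by (simp add: DERIV_def)
  then have elim: "((\<lambda>h. (exp (- \<mu> * h) - 1) / h) \<longlongrightarrow> - \<mu>) (at_right 0)"
    using filterlim_at_split by blast
  have "((\<lambda>h. exp (- \<mu> * h)) \<longlongrightarrow> exp (- \<mu> * 0)) (at_right (0::real))"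
    by (intro tendsto_intros)
  then have e1: "((\<lambda>h. exp (- \<mu> * h)) \<longlongrightarrow> 1) (at_right (0::real))" by simp
  have "((\<lambda>h. exp (\<mu> * h)) \<longlongrightarrow> exp (\<mu> * 0)) (at_right (0::real))"
    by (intro tendsto_intros)
  then have e2: "((\<lambda>h. exp (\<mu> * h)) \<longlongrightarrow> 1) (at_right (0::real))" by simp
  have to: "S.gen x (y - \<mu> *\<^sub>R x)" if "gen x y" for x y
  proof -
    have "((\<lambda>h. exp (- \<mu> * h) *\<^sub>R ((1 / h) *\<^sub>R (T h x - x)) + ((exp (- \<mu> * h) - 1) / h) *\<^sub>R x)
        \<longlongrightarrow> 1 *\<^sub>R y + (- \<mu>) *\<^sub>R x) (at_right 0)"
      using that unfolding gen_def by (intro tendsto_intros e1 elim)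
    moreover have "exp (- \<mu> * h) *\<^sub>R ((1 / h) *\<^sub>R (T h x - x)) + ((exp (- \<mu> * h) - 1) / h) *\<^sub>R x =
        (1 / h) *\<^sub>R (S h x - x)" for h
      by (simp add: S_def blinfun.scaleR_left scaleR_diff_right scaleR_diff_left diff_divide_distrib)
    ultimately show ?thesis unfolding S.gen_def by simp
  qed
  have from_S: "gen x (z + \<mu> *\<^sub>R x)" if "S.gen x z" for x z
  proof -
    have "((\<lambda>h. exp (\<mu> * h) *\<^sub>R ((1 / h) *\<^sub>R (S h x - x) - ((exp (- \<mu> * h) - 1) / h) *\<^sub>R x))
        \<longlongrightarrow> 1 *\<^sub>R (z - (- \<mu>) *\<^sub>R x)) (at_right 0)"
      using that unfolding S.gen_def by (intro tendsto_intros e2 elim)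
    moreover have "exp (\<mu> * h) *\<^sub>R ((1 / h) *\<^sub>R (S h x - x) - ((exp (- \<mu> * h) - 1) / h) *\<^sub>R x) =
        (1 / h) *\<^sub>R (T h x - x)" for h
    proof -
      have "(1 / h) *\<^sub>R (S h x - x) - ((exp (- \<mu> * h) - 1) / h) *\<^sub>R x = exp (- \<mu> * h) *\<^sub>R ((1 / h) *\<^sub>R (T h x - x))"
        by (simp add: S_def blinfun.scaleR_left scaleR_diff_right scaleR_diff_left diff_divide_distrib)
      then show ?thesis by (simp add: exp_minus)
    qed
    ultimately show ?thesis unfolding gen_def by simp
  qed
  obtain R :: "'a \<Rightarrow>\<^sub>L 'a" where R: "\<And>x. S.gen (R x) (- x)" "\<And>x y. S.gen x y \<Longrightarrow> R y = - x"
    using S.resolvent_exists_neg \<mu> by auto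
  have "gen (R x) (\<mu> *\<^sub>R R x - x)" for x using from_S[OF R(1)[of x]] by simp
  moreover have "R (\<mu> *\<^sub>R x - y) = x" if "gen x y" for x y
    using R(2)[OF to[OF that]] by (metis blinfun.minus_right minus_diff_eq minus_minus)
  ultimately show ?thesis unfolding is_resolvent_def by blast
qed

section \<open>Volterra equations\<close>

lemma compact_norm_bound:
  fixes f :: "'b::topological_space \<Rightarrow> 'c::real_normed_vector"
  assumes "compact S" "continuous_on S f"
  obtains K where "K > 0" "\<And>x. x \<in> S \<Longrightarrow> norm (f x) \<le> K"
proof -
  have "bounded (f ` S)" by (intro compact_imp_bounded compact_continuous_image assms)
  then show ?thesis using that unfolding bounded_pos by auto
qed

context strongly_continuous_semigroup
begin

lemma conv_integrable:
  assumes "continuous_on {0..\<tau>} k"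
  shows "(\<lambda>r. Tp (\<tau> - r) (k r)) integrable_on {0..\<tau>}"
  by (intro integrable_continuous_real continuous_intros assms)

lemma conv_norm_le:
  assumes k: "continuous_on {0..\<tau>} k" and \<tau>: "\<tau> \<le> N"
  shows "norm (integral {0..\<tau>} (\<lambda>r. Tp (\<tau> - r) (k r)))
           \<le> max 0 M * exp (\<bar>\<omega>\<bar> * N) * integral {0..\<tau>} (\<lambda>r. norm (k r))"
proof -
  have "norm (integral {0..\<tau>} (\<lambda>r. Tp (\<tau> - r) (k r)))
      \<le> integral {0..\<tau>} (\<lambda>r. max 0 M * exp (\<bar>\<omega>\<bar> * N) * norm (k r))"
  proof (rule integral_norm_bound_integral[OF conv_integrable[OF k]])
    show "(\<lambda>r. max 0 M * exp (\<bar>\<omega>\<bar> * N) * norm (k r)) integrable_on {0..\<tau>}"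
      by (intro integrable_continuous_real continuous_intros k)
    fix r assume "r \<in> {0..\<tau>}"
    then have "norm (Tp (\<tau> - r)) \<le> max 0 M * exp (\<bar>\<omega>\<bar> * N)"
      using \<tau> by (intro Tp_bound) auto
    then show "norm (Tp (\<tau> - r) (k r)) \<le> max 0 M * exp (\<bar>\<omega>\<bar> * N) * norm (k r)"
      by (meson norm_blinfun mult_right_mono norm_ge_zero order_trans)
  qed
  then show ?thesis by simp
qed

lemma volterra_unique:
  assumes P: "continuous_on {0..N} P" and d: "continuous_on {0..N} d"
    and eq: "\<And>\<tau>. \<tau> \<in> {0..N} \<Longrightarrow> d \<tau> = integral {0..\<tau>} (\<lambda>r. Tp (\<tau> - r) (blinfun_apply (P r) (d r)))"
    and \<tau>: "\<tau> \<in> {0..N}"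
  shows "d \<tau> = 0"
proof -
  obtain K where K: "K > 0" "\<And>r. r \<in> {0..N} \<Longrightarrow> norm (P r) \<le> K"
    using compact_norm_bound[OF compact_Icc P] by blast
  define C where "C = max 0 M * exp (\<bar>\<omega>\<bar> * N)"
  have C: "C \<ge> 0" by (simp add: C_def)
  have "norm (d \<tau>) \<le> 0"
  proof (rule gronwall_zero[where L = "C * K", OF _ _ _ \<tau>])
    show "continuous_on {0..N} (\<lambda>\<tau>. norm (d \<tau>))" by (intro continuous_intros d)
    show "0 \<le> C * K" using C K by simp
    fix t assume t: "t \<in> {0..N}"
    have dt: "continuous_on {0..t} d" and Pt: "continuous_on {0..t} P"
      using d P t by (auto elim: continuous_on_subset)
    have "norm (d t) \<le> C * integral {0..t} (\<lambda>r. norm (P r (d r)))"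
      unfolding C_def eq[OF t]
      by (rule conv_norm_le) (use t in \<open>auto intro!: continuous_intros dt Pt\<close>)
    also have "integral {0..t} (\<lambda>r. norm (P r (d r))) \<le> integral {0..t} (\<lambda>r. K * norm (d r))"
    proof (rule integral_le)
      fix r assume "r \<in> {0..t}"
      then have "norm (P r) \<le> K" using t K by auto
      then show "norm (P r (d r)) \<le> K * norm (d r)"
        by (meson norm_blinfun mult_right_mono norm_ge_zero order_trans)
    qed (intro integrable_continuous_real continuous_intros dt Pt)+
    finally show "norm (d t) \<le> C * K * integral {0..t} (\<lambda>r. norm (d r))"
      using C by (simp add: mult_left_mono mult.assoc)
  qed
  then show ?thesis by simp
qed

text \<open>
  For \<open>\<tau> \<ge> 0\<close> the substitution \<open>r = \<tau> * \<theta>\<close> turns this into the integral of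
  \<open>T (\<tau> - r) (P (s + r) (\<phi> (s, r)))\<close> over \<open>{0..\<tau>}\<close>; with the fixed domain \<open>{0..1}\<close> joint continuity
  in \<open>(s, \<tau>)\<close> is immediate.
\<close>

definition volterra_op ::
  "(real \<Rightarrow> 'a \<Rightarrow>\<^sub>L 'a) \<Rightarrow> (real \<times> real \<Rightarrow> 'a) \<Rightarrow> real \<times> real \<Rightarrow> 'a" where
  "volterra_op P \<phi> = (\<lambda>z. integral {0..1} (\<lambda>\<theta>.
     snd z *\<^sub>R Tp (snd z * (1 - \<theta>)) (P (fst z + snd z * \<theta>) (\<phi> (fst z, snd z * \<theta>)))))"

text \<open>Arbitrary continuous \<open>f\<close> and \<open>g\<close> let one statement serve both
  integrability in \<theta> and joint continuity in the parameters.\<close>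

lemma volterra_op_integrand_cont:
  assumes P: "continuous_on UNIV P" and \<phi>: "continuous_on UNIV \<phi>"
    and f: "continuous_on S f" and g: "continuous_on S g"
  shows "continuous_on S (\<lambda>x. snd (f x) *\<^sub>R Tp (snd (f x) * (1 - g x))
     (blinfun_apply (P (fst (f x) + snd (f x) * g x)) (\<phi> (fst (f x), snd (f x) * g x))))"
  by (intro continuous_intros continuous_on_compose2[OF P] continuous_on_compose2[OF \<phi>] f g) auto

lemma volterra_op_cont:
  assumes P: "continuous_on UNIV P" and \<phi>: "continuous_on UNIV \<phi>"
  shows "continuous_on UNIV (volterra_op P \<phi>)"
  unfolding volterra_op_def cbox_interval[symmetric]
  by (rule integral_continuous_on_param, unfold split_beta, rule volterra_op_integrand_cont[OF P \<phi>])
     (intro continuous_intros)+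

lemma volterra_op_eq:
  assumes "\<tau> \<ge> 0"
  shows "volterra_op P \<phi> (s, \<tau>) = integral {0..\<tau>} (\<lambda>r. Tp (\<tau> - r) (P (s + r) (\<phi> (s, r))))"
proof (cases "\<tau> = 0")
  case False
  then have \<tau>: "\<tau> > 0" using assms by simp
  have "integral {0..1} (\<lambda>\<theta>. Tp (\<tau> - \<tau> * \<theta>) (P (s + \<tau> * \<theta>) (\<phi> (s, \<tau> * \<theta>)))) =
      (1 / \<tau>) *\<^sub>R integral {0..\<tau>} (\<lambda>r. Tp (\<tau> - r) (P (s + r) (\<phi> (s, r))))"
    using integral_stretch_real[of \<tau> 0 \<tau> "\<lambda>r. Tp (\<tau> - r) (P (s + r) (\<phi> (s, r)))"] \<tau>
    by (simp add: image_divide_atLeastAtMost)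
  then show ?thesis using \<tau> by (simp add: volterra_op_def right_diff_distrib)
qed (simp add: volterra_op_def)

lemma volterra_op_add:
  assumes P: "continuous_on UNIV P" and \<phi>: "continuous_on UNIV \<phi>" and \<psi>: "continuous_on UNIV \<psi>"
  shows "volterra_op P (\<lambda>z. \<phi> z + \<psi> z) z = volterra_op P \<phi> z + volterra_op P \<psi> z"
  unfolding volterra_op_def blinfun.add_right scaleR_add_right
  by (intro integral_add integrable_continuous_real volterra_op_integrand_cont[OF P] \<phi> \<psi> continuous_intros)

lemma volterra_op_diff:
  assumes P: "continuous_on UNIV P" and \<phi>: "continuous_on UNIV \<phi>" and \<psi>: "continuous_on UNIV \<psi>"
  shows "volterra_op P (\<lambda>z. \<phi> z - \<psi> z) z = volterra_op P \<phi> z - volterra_op P \<psi> z"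
  using volterra_op_add[OF P _ \<psi>, of "\<lambda>z. \<phi> z - \<psi> z" z] \<phi> \<psi>
  by (simp add: continuous_intros)

text \<open>One application gains the factor \<open>L * \<bar>\<tau>\<bar> / (n + 1)\<close>, the
  denominator being the integral of \<open>\<theta> ^ n\<close>. The argument
  \<open>s + \<tau> * \<theta>\<close> ranges over an interval of radius \<open>2 * N\<close>, hence
  the range of the bound on \<open>P\<close>; absolute values occur because \<open>\<tau>\<close>
  may be negative.\<close>

lemma volterra_op_bound:
  assumes P: "continuous_on UNIV P" and \<phi>: "continuous_on UNIV \<phi>"
    and K: "\<And>r. r \<in> {- (2 * N)..2 * N} \<Longrightarrow> norm (P r) \<le> K"
    and L: "L = max 0 M * exp (\<bar>\<omega>\<bar> * N) * K"
    and bd: "\<And>s \<tau>. \<bar>s\<bar> \<le> N \<Longrightarrow> \<bar>\<tau>\<bar> \<le> N \<Longrightarrow> norm (\<phi> (s, \<tau>)) \<le> c * (L * \<bar>\<tau>\<bar>) ^ n / fact n"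
    and s: "\<bar>s\<bar> \<le> N" and \<tau>: "\<bar>\<tau>\<bar> \<le> N"
  shows "norm (volterra_op P \<phi> (s, \<tau>)) \<le> c * (L * \<bar>\<tau>\<bar>) ^ Suc n / fact (Suc n)"
proof -
  define C where "C = max 0 M * exp (\<bar>\<omega>\<bar> * N)"
  define D where "D = c * (L * \<bar>\<tau>\<bar>) ^ Suc n / fact n"
  have "((\<lambda>\<theta>. \<theta> ^ n) has_integral (1 ^ Suc n / real (Suc n) - 0 ^ Suc n / real (Suc n))) {0..1::real}"
    by (rule fundamental_theorem_of_calculus)
       (auto simp del: power_Suc simp flip: has_real_derivative_iff_has_vector_derivative
         intro!: derivative_eq_intros)
  then have pow: "((\<lambda>\<theta>. D * \<theta> ^ n) has_integral D * (1 / real (Suc n))) {0..1::real}"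
    by (intro has_integral_mult_right) simp
  have "norm (volterra_op P \<phi> (s, \<tau>)) \<le> integral {0..1} (\<lambda>\<theta>. D * \<theta> ^ n)"
    unfolding volterra_op_def
  proof (rule integral_norm_bound_integral)
    show "(\<lambda>\<theta>. snd (s, \<tau>) *\<^sub>R Tp (snd (s, \<tau>) * (1 - \<theta>))
       (P (fst (s, \<tau>) + snd (s, \<tau>) * \<theta>) (\<phi> (fst (s, \<tau>), snd (s, \<tau>) * \<theta>)))) integrable_on {0..1}"
      by (intro integrable_continuous_real volterra_op_integrand_cont[OF P \<phi>] continuous_intros)
    show "(\<lambda>\<theta>. D * \<theta> ^ n) integrable_on {0..1}" using pow by (rule has_integral_integrable)
    fix \<theta> :: real assume \<theta>: "\<theta> \<in> {0..1}"
    have le1: "\<bar>\<tau> * \<theta>\<bar> \<le> N" "\<bar>\<tau> * (1 - \<theta>)\<bar> \<le> N"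
      using mult_mono[of "\<bar>\<tau>\<bar>" N \<theta> 1] mult_mono[of "\<bar>\<tau>\<bar>" N "1 - \<theta>" 1] \<theta> \<tau> by (auto simp: abs_mult)
    have b1: "norm (Tp (\<tau> * (1 - \<theta>))) \<le> C" unfolding C_def by (rule Tp_bound[OF le1(2)])
    have b2: "norm (P (s + \<tau> * \<theta>)) \<le> K" using le1 s by (intro K) auto
    have b3: "norm (\<phi> (s, \<tau> * \<theta>)) \<le> c * (L * \<bar>\<tau> * \<theta>\<bar>) ^ n / fact n" by (rule bd[OF s le1(1)])
    have C: "C \<ge> 0" and K0: "K \<ge> 0" using b1 b2 norm_ge_zero order_trans by blast+
    have "norm (Tp (\<tau> * (1 - \<theta>)) (P (s + \<tau> * \<theta>) (\<phi> (s, \<tau> * \<theta>))))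
        \<le> norm (Tp (\<tau> * (1 - \<theta>))) * (norm (P (s + \<tau> * \<theta>)) * norm (\<phi> (s, \<tau> * \<theta>)))"
      by (meson norm_blinfun mult_left_mono norm_ge_zero order_trans)
    also have "\<dots> \<le> C * (K * (c * (L * \<bar>\<tau> * \<theta>\<bar>) ^ n / fact n))"
      by (intro mult_mono b1 b2 b3 mult_nonneg_nonneg C K0 norm_ge_zero)
    finally have "\<bar>\<tau>\<bar> * norm (Tp (\<tau> * (1 - \<theta>)) (P (s + \<tau> * \<theta>) (\<phi> (s, \<tau> * \<theta>))))
        \<le> \<bar>\<tau>\<bar> * (C * (K * (c * (L * \<bar>\<tau> * \<theta>\<bar>) ^ n / fact n)))"
      by (rule mult_left_mono) simp
    also have "\<dots> = D * \<theta> ^ n"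
      using \<theta> by (simp add: D_def L C_def abs_mult power_mult_distrib)
    finally show "norm (snd (s, \<tau>) *\<^sub>R Tp (snd (s, \<tau>) * (1 - \<theta>))
       (P (fst (s, \<tau>) + snd (s, \<tau>) * \<theta>) (\<phi> (fst (s, \<tau>), snd (s, \<tau>) * \<theta>)))) \<le> D * \<theta> ^ n"
      by simp
  qed
  also have "\<dots> = D * (1 / real (Suc n))" using pow by (rule integral_unique)
  also have "\<dots> = c * (L * \<bar>\<tau>\<bar>) ^ Suc n / fact (Suc n)"
    by (simp add: D_def)
  finally show ?thesis .
qed

section \<open>The Neumann series of the Volterra operator\<close>

definition volterra ::
  "(real \<Rightarrow> 'a \<Rightarrow>\<^sub>L 'a) \<Rightarrow> (real \<times> real \<Rightarrow> 'a) \<Rightarrow> real \<times> real \<Rightarrow> 'a" where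
  "volterra P \<phi> z = (\<Sum>n. (volterra_op P ^^ n) \<phi> z)"

lemma volterra_iterate_cont:
  assumes P: "continuous_on UNIV P" and \<phi>: "continuous_on UNIV \<phi>"
  shows "continuous_on UNIV ((volterra_op P ^^ n) \<phi>)"
  by (induction n) (use assms volterra_op_cont in auto)

text \<open>Shrinking the second coordinate by a factor \<theta> in {0..1} stays inside the box, so
  bounds on a box survive iteration.\<close>

definition volterra_box :: "real \<Rightarrow> (real \<times> real) set" where
  "volterra_box N = {- N..N} \<times> {- N..N}"

lemma volterra_boxI: "\<bar>s\<bar> \<le> N \<Longrightarrow> \<bar>\<tau>\<bar> \<le> N \<Longrightarrow> (s, \<tau>) \<in> volterra_box N"
  by (auto simp: volterra_box_def abs_le_iff)

text \<open>\<open>L\<close> is chosen before \<open>\<phi>\<close>. The same constant thus controls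
  the series, the error made by truncating it, and the size of the solution in terms of its
  forcing.\<close>

lemma volterra_series:
  assumes P: "continuous_on UNIV P" and "N \<ge> 0"
  obtains L where "L \<ge> 0"
    "\<And>\<phi> c n s \<tau>. continuous_on UNIV \<phi> \<Longrightarrow> (\<And>z. z \<in> volterra_box N \<Longrightarrow> norm (\<phi> z) \<le> c) \<Longrightarrow>
        (s, \<tau>) \<in> volterra_box N \<Longrightarrow>
        norm ((volterra_op P ^^ n) \<phi> (s, \<tau>)) \<le> c * (L * \<bar>\<tau>\<bar>) ^ n / fact n"
proof -
  obtain K where K: "K > 0" "\<And>r. r \<in> {- (2 * N)..2 * N} \<Longrightarrow> norm (P r) \<le> K"
    using compact_norm_bound[OF compact_Icc continuous_on_subset[OF P subset_UNIV]] by blast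
  define L where "L = max 0 M * exp (\<bar>\<omega>\<bar> * N) * K"
  show ?thesis
  proof
    show "L \<ge> 0" using K by (simp add: L_def)
    fix \<phi> :: "real \<times> real \<Rightarrow> 'a" and c n s \<tau>
    assume \<phi>: "continuous_on UNIV \<phi>" and c: "\<And>z. z \<in> volterra_box N \<Longrightarrow> norm (\<phi> z) \<le> c"
    show "(s, \<tau>) \<in> volterra_box N \<Longrightarrow> norm ((volterra_op P ^^ n) \<phi> (s, \<tau>)) \<le> c * (L * \<bar>\<tau>\<bar>) ^ n / fact n"
    proof (induction n arbitrary: s \<tau>)
      case 0
      then show ?case using c by simp
    next
      case (Suc n)
      have "norm (volterra_op P ((volterra_op P ^^ n) \<phi>) (s, \<tau>)) \<le> c * (L * \<bar>\<tau>\<bar>) ^ Suc n / fact (Suc n)"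
      proof (rule volterra_op_bound[OF P volterra_iterate_cont[OF P \<phi>] K(2) L_def])
        show "norm ((volterra_op P ^^ n) \<phi> (s, \<tau>)) \<le> c * (L * \<bar>\<tau>\<bar>) ^ n / fact n"
          if "\<bar>s\<bar> \<le> N" "\<bar>\<tau>\<bar> \<le> N" for s \<tau>
          by (rule Suc.IH) (rule volterra_boxI[OF that])
      qed (use Suc.prems in \<open>auto simp: volterra_box_def abs_le_iff\<close>)
      then show ?case by simp
    qed
  qed
qed

lemma volterra_uniform_limit:
  assumes P: "continuous_on UNIV P" and \<phi>: "continuous_on UNIV \<phi>" and N: "N \<ge> 0"
  shows "uniform_limit (volterra_box N) (\<lambda>m z. \<Sum>n<m. (volterra_op P ^^ n) \<phi> z) (volterra P \<phi>) sequentially"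
proof -
  obtain L where L: "L \<ge> 0" and bd: "\<And>\<phi> c n s \<tau>. continuous_on UNIV \<phi> \<Longrightarrow>
      (\<And>z. z \<in> volterra_box N \<Longrightarrow> norm (\<phi> z) \<le> c) \<Longrightarrow> (s, \<tau>) \<in> volterra_box N \<Longrightarrow>
        norm ((volterra_op P ^^ n) \<phi> (s, \<tau>)) \<le> c * (L * \<bar>\<tau>\<bar>) ^ n / fact n"
    using volterra_series[OF P N] by metis
  have "compact (volterra_box N)" unfolding volterra_box_def by (intro compact_Times compact_Icc)
  then obtain c where c: "c > 0" "\<And>z. z \<in> volterra_box N \<Longrightarrow> norm (\<phi> z) \<le> c"
    using compact_norm_bound[OF _ continuous_on_subset[OF \<phi> subset_UNIV]] by blast
  show ?thesis
    unfolding volterra_def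
  proof (rule Weierstrass_m_test)
    show "summable (\<lambda>n. c * ((L * N) ^ n / fact n))"
      using summable_exp_generic[of "L * N"] by (intro summable_mult) (simp add: divide_inverse mult.commute)
    fix n z assume z: "z \<in> volterra_box N"
    obtain s \<tau> where st: "z = (s, \<tau>)" by (cases z)
    have "norm ((volterra_op P ^^ n) \<phi> z) \<le> c * (L * \<bar>\<tau>\<bar>) ^ n / fact n"
      unfolding st by (rule bd[OF \<phi> c(2)]) (use z st in auto)
    also have "\<dots> = c * ((L * \<bar>\<tau>\<bar>) ^ n / fact n)" by simp
    also have "\<dots> \<le> c * ((L * N) ^ n / fact n)"
      using z st L c by (intro mult_left_mono divide_right_mono power_mono) (auto simp: volterra_box_def)
    finally show "norm ((volterra_op P ^^ n) \<phi> z) \<le> c * ((L * N) ^ n / fact n)" .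
  qed
qed

lemma volterra_cont:
  assumes P: "continuous_on UNIV P" and \<phi>: "continuous_on UNIV \<phi>"
  shows "continuous_on UNIV (volterra P \<phi>)"
  unfolding continuous_on_eq_continuous_at[OF open_UNIV]
proof
  fix z :: "real \<times> real"
  define N where "N = \<bar>fst z\<bar> + \<bar>snd z\<bar> + 1"
  have "continuous_on (volterra_box N) (volterra P \<phi>)"
  proof (rule uniform_limit_theorem[OF _ volterra_uniform_limit[OF P \<phi>]])
    show "\<forall>\<^sub>F m in sequentially. continuous_on (volterra_box N) (\<lambda>z. \<Sum>n<m. (volterra_op P ^^ n) \<phi> z)"
      by (intro always_eventually allI continuous_on_sum continuous_on_subset[OF volterra_iterate_cont[OF P \<phi>]]) auto
  qed (auto simp: N_def)
  moreover have "{- N<..<N} \<times> {- N<..<N} \<subseteq> volterra_box N" by (auto simp: volterra_box_def)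
  ultimately have "continuous_on ({- N<..<N} \<times> {- N<..<N}) (volterra P \<phi>)"
    by (rule continuous_on_subset)
  moreover have "z \<in> {- N<..<N} \<times> {- N<..<N}" by (cases z) (auto simp: N_def)
  ultimately show "isCont (volterra P \<phi>) z"
    using continuous_on_eq_continuous_at[OF open_Times[OF open_greaterThanLessThan open_greaterThanLessThan]]
    by blast
qed

lemma volterra_op_partial_sum:
  assumes P: "continuous_on UNIV P" and \<phi>: "continuous_on UNIV \<phi>"
  shows "volterra_op P (\<lambda>z. \<Sum>n<m. (volterra_op P ^^ n) \<phi> z) z = (\<Sum>n<m. (volterra_op P ^^ Suc n) \<phi> z)"
proof (induction m)
  case 0
  then show ?case by (simp add: volterra_op_def)
next
  case (Suc m)
  have "continuous_on UNIV (\<lambda>z. \<Sum>n<m. (volterra_op P ^^ n) \<phi> z)"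
    by (intro continuous_on_sum volterra_iterate_cont P \<phi>)
  from volterra_op_add[OF P this volterra_iterate_cont[OF P \<phi>, of m]] Suc show ?case by simp
qed

lemma volterra_eq:
  assumes P: "continuous_on UNIV P" and \<phi>: "continuous_on UNIV \<phi>"
  shows "volterra P \<phi> z = \<phi> z + volterra_op P (volterra P \<phi>) z"
proof -
  obtain s \<tau> where st: "z = (s, \<tau>)" by (cases z)
  define N where "N = \<bar>s\<bar> + \<bar>\<tau>\<bar> + 1"
  have N: "N > 0" and z: "z \<in> volterra_box N" by (auto simp: N_def st volterra_box_def)
  define S where "S = (\<lambda>m z. \<Sum>n<m. (volterra_op P ^^ n) \<phi> z)"
  have S: "continuous_on UNIV (S m)" for m
    unfolding S_def by (intro continuous_on_sum volterra_iterate_cont P \<phi>)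
  have ul: "uniform_limit (volterra_box N) S (volterra P \<phi>) sequentially"
    unfolding S_def using volterra_uniform_limit[OF P \<phi>] N by simp
  obtain L where L: "L \<ge> 0" and bd: "\<And>\<phi> c n s \<tau>. continuous_on UNIV \<phi> \<Longrightarrow>
      (\<And>z. z \<in> volterra_box N \<Longrightarrow> norm (\<phi> z) \<le> c) \<Longrightarrow> (s, \<tau>) \<in> volterra_box N \<Longrightarrow>
        norm ((volterra_op P ^^ n) \<phi> (s, \<tau>)) \<le> c * (L * \<bar>\<tau>\<bar>) ^ n / fact n"
    using volterra_series[OF P] N by (metis less_imp_le)
  have lim1: "(\<lambda>m. volterra_op P (S m) z) \<longlonglongrightarrow> volterra_op P (volterra P \<phi>) z"
  proof (rule tendstoI)
    fix e :: real assume e: "e > 0"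
    \<comment> \<open>The estimate for a single iteration turns a uniform error \<open>e'\<close> on
      the box into at most \<open>e' * (L * N)\<close>. The added \<open>1\<close> makes the
      denominator positive and the final inequality strict.\<close>
    define e' where "e' = e / (L * N + 1)"
    have e': "e' > 0" using e L N by (simp add: e'_def add_nonneg_pos)
    show "\<forall>\<^sub>F m in sequentially. dist (volterra_op P (S m) z) (volterra_op P (volterra P \<phi>) z) < e"
      using uniform_limitD[OF ul e']
    proof eventually_elim
      case (elim m)
      have "norm (volterra_op P (\<lambda>z. S m z - volterra P \<phi> z) z) \<le> e' * (L * \<bar>\<tau>\<bar>)"
        using bd[of "\<lambda>z. S m z - volterra P \<phi> z" e' s \<tau> 1] elim z
        by (force simp: st dist_norm less_imp_le intro!: continuous_intros S volterra_cont P \<phi>)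
      also have "\<dots> \<le> e' * (L * N)"
        using e' L by (intro mult_left_mono) (auto simp: N_def)
      also have "\<dots> < e' * (L * N + 1)" using e' by simp
      also have "L * N + 1 > 0" using L N by (simp add: add_nonneg_pos)
      then have "e' * (L * N + 1) = e" by (simp add: e'_def)
      finally show ?case
        using volterra_op_diff[OF P S volterra_cont[OF P \<phi>]] by (simp add: dist_norm)
    qed
  qed
  have "(\<lambda>m. S (Suc m) z) \<longlonglongrightarrow> volterra P \<phi> z"
    using tendsto_uniform_limitI[OF ul z] by (rule LIMSEQ_Suc)
  moreover have "S (Suc m) z = \<phi> z + volterra_op P (S m) z" for m
    using volterra_op_partial_sum[OF P \<phi>, of m z]
    by (simp add: S_def sum.lessThan_Suc_shift del: sum.lessThan_Suc)
  moreover have "(\<lambda>m. \<phi> z + volterra_op P (S m) z) \<longlonglongrightarrow> \<phi> z + volterra_op P (volterra P \<phi>) z"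
    by (intro tendsto_intros lim1)
  ultimately show ?thesis using LIMSEQ_unique by simp
qed

text \<open>Summing the iterate bounds gives the exponential series, so \<open>C\<close> is
  \<open>exp (L * N)\<close>. Its independence of \<open>\<phi>\<close> makes the solution operators
  bounded, uniformly on the box.\<close>

lemma volterra_bound:
  assumes P: "continuous_on UNIV P" and N: "N \<ge> 0"
  obtains C where "C \<ge> 0"
    "\<And>\<phi> c z. continuous_on UNIV \<phi> \<Longrightarrow> (\<And>z. z \<in> volterra_box N \<Longrightarrow> norm (\<phi> z) \<le> c) \<Longrightarrow>
       z \<in> volterra_box N \<Longrightarrow> norm (volterra P \<phi> z) \<le> C * c"
proof -
  obtain L where L: "L \<ge> 0" and bd: "\<And>\<phi> c n s \<tau>. continuous_on UNIV \<phi> \<Longrightarrow>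
      (\<And>z. z \<in> volterra_box N \<Longrightarrow> norm (\<phi> z) \<le> c) \<Longrightarrow> (s, \<tau>) \<in> volterra_box N \<Longrightarrow>
        norm ((volterra_op P ^^ n) \<phi> (s, \<tau>)) \<le> c * (L * \<bar>\<tau>\<bar>) ^ n / fact n"
    using volterra_series[OF P N] by metis
  show ?thesis
  proof
    show "exp (L * N) \<ge> 0" by simp
    fix \<phi> :: "real \<times> real \<Rightarrow> 'a" and c z
    assume \<phi>: "continuous_on UNIV \<phi>" and c: "\<And>z. z \<in> volterra_box N \<Longrightarrow> norm (\<phi> z) \<le> c"
      and z: "z \<in> volterra_box N"
    obtain s \<tau> where st: "z = (s, \<tau>)" by (cases z)
    have c0: "c \<ge> 0" using c[OF z] norm_ge_zero order_trans by blast
    have sums: "(\<lambda>n. c * ((L * \<bar>\<tau>\<bar>) ^ n / fact n)) sums (c * exp (L * \<bar>\<tau>\<bar>))"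
      using exp_converges[of "L * \<bar>\<tau>\<bar>"] by (intro sums_mult) (simp add: divide_inverse mult.commute)
    have le: "norm ((volterra_op P ^^ n) \<phi> z) \<le> c * ((L * \<bar>\<tau>\<bar>) ^ n / fact n)" for n
      using bd[OF \<phi> c, of s \<tau> n] z st by simp
    have "norm (volterra P \<phi> z) \<le> (\<Sum>n. c * ((L * \<bar>\<tau>\<bar>) ^ n / fact n))"
      unfolding volterra_def by (rule norm_suminf_le[OF le sums_summable[OF sums]])
    also have "\<dots> = c * exp (L * \<bar>\<tau>\<bar>)" using sums by (rule sums_unique[symmetric])
    also have "\<dots> \<le> exp (L * N) * c"
      using c0 L z st by (simp add: volterra_box_def mult.commute abs_le_iff mult_right_mono mult_left_mono)
    finally show "norm (volterra P \<phi> z) \<le> exp (L * N) * c" .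
  qed
qed

end

section \<open>The evolution family of a norm continuous perturbation\<close>

context strongly_continuous_semigroup
begin

definition conv :: "(real \<Rightarrow> 'a) \<Rightarrow> real \<Rightarrow> 'a" where
  "conv k \<tau> = integral {0..\<tau>} (\<lambda>r. Tp (\<tau> - r) (k r))"

text \<open>Split the integral at \<open>\<sigma>\<close>: on the first piece the semigroup law lets
  \<open>T \<delta>\<close> factor out, the second is translated to start at \<open>0\<close>. The
  cocycle law and all increment formulas rest on this.\<close>

lemma conv_shift:
  assumes k: "continuous_on UNIV k" and "\<sigma> \<ge> 0" "\<delta> \<ge> 0"
  shows "conv k (\<sigma> + \<delta>) = T \<delta> (conv k \<sigma>) + conv (\<lambda>r. k (\<sigma> + r)) \<delta>"
proof -
  note kc [continuous_intros] = continuous_on_compose2[OF k]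
  have int: "(\<lambda>r. Tp (c - r) (k r)) integrable_on {a..b}" for a b c
    by (intro integrable_continuous_real continuous_intros) auto
  have "T \<delta> (conv k \<sigma>) = integral {0..\<sigma>} (\<lambda>r. T \<delta> (Tp (\<sigma> - r) (k r)))"
    unfolding conv_def
    using integral_linear[OF int[of \<sigma> 0 \<sigma>] blinfun.bounded_linear_right[of "T \<delta>"]] by (simp add: o_def)
  also have "\<dots> = integral {0..\<sigma>} (\<lambda>r. Tp (\<sigma> + \<delta> - r) (k r))"
  proof (rule integral_cong)
    fix r assume "r \<in> {0..\<sigma>}"
    then show "T \<delta> (Tp (\<sigma> - r) (k r)) = Tp (\<sigma> + \<delta> - r) (k r)"
      using T_add[of \<delta> "\<sigma> - r"] assms by (simp add: algebra_simps)
  qed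
  finally have 1: "T \<delta> (conv k \<sigma>) = integral {0..\<sigma>} (\<lambda>r. Tp (\<sigma> + \<delta> - r) (k r))" .
  have 2: "conv (\<lambda>r. k (\<sigma> + r)) \<delta> = integral {\<sigma>..\<sigma> + \<delta>} (\<lambda>r. Tp (\<sigma> + \<delta> - r) (k r))"
    using integral_shift_real_ivl[of \<sigma> \<sigma> "\<sigma> + \<delta>" "\<lambda>r. Tp (\<sigma> + \<delta> - r) (k r)"]
    by (simp add: conv_def algebra_simps)
  show ?thesis
    unfolding 1 2 using Henstock_Kurzweil_Integration.integral_combine[OF _ _ int, of 0 \<sigma> "\<sigma> + \<delta>" "\<sigma> + \<delta>"] assms
    by (simp add: conv_def)
qed

lemma mild_shift:
  assumes h: "continuous_on UNIV h" and "\<sigma> \<ge> 0" "\<delta> \<ge> 0"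
  shows "T (\<sigma> + \<delta>) x + conv h (\<sigma> + \<delta>) = T \<delta> (T \<sigma> x + conv h \<sigma>) + conv (\<lambda>r. h (\<sigma> + r)) \<delta>"
  using conv_shift[OF assms] T_add[of \<delta> \<sigma>] assms by (simp add: blinfun.add_right add.commute)

section \<open>Mild solutions and the evolution operators\<close>

text \<open>Negative elapsed times get the value at \<open>0\<close>, which keeps the map continuous
  on the whole plane.\<close>

definition mild :: "(real \<Rightarrow> 'a \<Rightarrow>\<^sub>L 'a) \<Rightarrow> real \<Rightarrow> real \<Rightarrow> 'a \<Rightarrow> 'a" where
  "mild P s \<tau> x = volterra P (\<lambda>z. Tp (snd z) x) (s, max 0 \<tau>)"

text \<open>The second argument is the elapsed time: \<open>evol P s \<tau>\<close> is \<open>U(s + \<tau>, s)\<close>.\<close>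

definition evol :: "(real \<Rightarrow> 'a \<Rightarrow>\<^sub>L 'a) \<Rightarrow> real \<Rightarrow> real \<Rightarrow> 'a \<Rightarrow>\<^sub>L 'a" where
  "evol P s \<tau> = Blinfun (mild P s \<tau>)"

context
  fixes P :: "real \<Rightarrow> 'a \<Rightarrow>\<^sub>L 'a"
  assumes P: "continuous_on UNIV P"
begin

lemma Tp_snd_cont: "continuous_on UNIV (\<lambda>z :: real \<times> real. Tp (snd z) x)"
  by (intro continuous_intros)

lemma mild_cont:
  assumes "continuous_on S f" "continuous_on S g"
  shows "continuous_on S (\<lambda>z. mild P (f z) (g z) x)"
  unfolding mild_def
  by (intro continuous_on_compose2[OF volterra_cont[OF P Tp_snd_cont]] continuous_intros assms) auto

lemma mild_eq:
  assumes "\<tau> \<ge> 0"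
  shows "mild P s \<tau> x = T \<tau> x + conv (\<lambda>r. P (s + r) (mild P s r x)) \<tau>"
proof -
  have "mild P s \<tau> x = T \<tau> x + volterra_op P (volterra P (\<lambda>z. Tp (snd z) x)) (s, \<tau>)"
    using volterra_eq[OF P Tp_snd_cont, of x "(s, \<tau>)"] assms by (simp add: mild_def)
  also have "volterra_op P (volterra P (\<lambda>z. Tp (snd z) x)) (s, \<tau>) = conv (\<lambda>r. P (s + r) (mild P s r x)) \<tau>"
    unfolding volterra_op_eq[OF assms] conv_def mild_def by (intro integral_cong) simp
  finally show ?thesis .
qed

text \<open>The difference of two solutions satisfies the homogeneous equation of
  \<open>volterra_unique\<close>. Commutation, additivity and the cocycle law below are each
  obtained by exhibiting a second solution.\<close>

lemma mild_unique:
  assumes u: "continuous_on {0..N} u"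
    and eq: "\<And>\<tau>. \<tau> \<in> {0..N} \<Longrightarrow> u \<tau> = T \<tau> x + conv (\<lambda>r. P (s + r) (u r)) \<tau>"
    and \<tau>: "\<tau> \<in> {0..N}"
  shows "u \<tau> = mild P s \<tau> x"
proof -
  have Ps: "continuous_on S (\<lambda>r. P (s + r))" for S
    by (intro continuous_on_compose2[OF P] continuous_intros) auto
  have m: "continuous_on S (\<lambda>r. mild P s r x)" for S by (intro mild_cont continuous_intros)
  have "u \<tau> - mild P s \<tau> x = 0"
  proof (rule volterra_unique[OF Ps, where d = "\<lambda>\<tau>. u \<tau> - mild P s \<tau> x" and N = N, OF _ _ \<tau>])
    show "continuous_on {0..N} (\<lambda>\<tau>. u \<tau> - mild P s \<tau> x)" by (intro continuous_intros u m)
    fix t assume t: "t \<in> {0..N}"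
    then have ut: "continuous_on {0..t} u" using u by (auto elim: continuous_on_subset)
    have "u t - mild P s t x = conv (\<lambda>r. P (s + r) (u r)) t - conv (\<lambda>r. P (s + r) (mild P s r x)) t"
      using eq[OF t] mild_eq[of t s x] t by simp
    also have "\<dots> = integral {0..t} (\<lambda>r. Tp (t - r) (P (s + r) (u r)) - Tp (t - r) (P (s + r) (mild P s r x)))"
      unfolding conv_def
      by (rule integral_diff[symmetric]) (intro conv_integrable continuous_intros Ps ut m)+
    finally show "u t - mild P s t x = integral {0..t} (\<lambda>r. Tp (t - r) (P (s + r) (u r - mild P s r x)))"
      by (simp add: blinfun.diff_right)
  qed
  then show ?thesis by simp
qed

lemma mild_bound:
  assumes N: "N \<ge> 0"
  obtains C where "C \<ge> 0" "\<And>s \<tau> x. \<bar>s\<bar> \<le> N \<Longrightarrow> \<tau> \<le> N \<Longrightarrow> norm (mild P s \<tau> x) \<le> C * norm x"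
proof -
  obtain C where C: "C \<ge> 0" "\<And>\<phi> c z. continuous_on UNIV \<phi> \<Longrightarrow>
      (\<And>z. z \<in> volterra_box N \<Longrightarrow> norm (\<phi> z) \<le> c) \<Longrightarrow> z \<in> volterra_box N \<Longrightarrow> norm (volterra P \<phi> z) \<le> C * c"
    using volterra_bound[OF P N] by metis
  define C' where "C' = max 0 M * exp (\<bar>\<omega>\<bar> * N)"
  show ?thesis
  proof
    show "C * C' \<ge> 0" using C by (simp add: C'_def)
    fix s \<tau> :: real and x assume st: "\<bar>s\<bar> \<le> N" "\<tau> \<le> N"
    have "norm (mild P s \<tau> x) \<le> C * (C' * norm x)"
      unfolding mild_def
    proof (rule C(2)[OF Tp_snd_cont])
      fix z assume "z \<in> volterra_box N"
      then have "norm (Tp (snd z)) \<le> C'" unfolding C'_def by (intro Tp_bound) (auto simp: volterra_box_def)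
      then show "norm (Tp (snd z) x) \<le> C' * norm x"
        by (meson norm_blinfun mult_right_mono norm_ge_zero order_trans)
    qed (use st N in \<open>intro volterra_boxI, auto\<close>)
    then show "norm (mild P s \<tau> x) \<le> C * C' * norm x" by (simp add: mult.assoc)
  qed
qed

text \<open>Applying \<open>f\<close> to the integral equation gives the equation with initial value
  \<open>f x\<close>. With \<open>f\<close> a multiplication by a scalar this yields homogeneity,
  real here and over \<open>scl\<close> in the end.\<close>

lemma mild_commute:
  assumes f: "bounded_linear f" and fT: "\<And>\<tau> x. \<tau> \<ge> 0 \<Longrightarrow> f (T \<tau> x) = T \<tau> (f x)"
    and fP: "\<And>r x. f (P r x) = P r (f x)" and \<tau>: "\<tau> \<ge> 0"
  shows "f (mild P s \<tau> x) = mild P s \<tau> (f x)"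
proof (rule mild_unique[where u = "\<lambda>\<tau>. f (mild P s \<tau> x)" and N = \<tau>])
  show "continuous_on {0..\<tau>} (\<lambda>\<tau>. f (mild P s \<tau> x))"
    by (intro bounded_linear.continuous_on[OF f] mild_cont continuous_intros)
  fix t assume t: "t \<in> {0..\<tau>}"
  have "continuous_on {0..t} (\<lambda>r. P (s + r) (mild P s r x))"
    by (intro continuous_intros continuous_on_compose2[OF P] mild_cont) auto
  from integral_linear[OF conv_integrable[OF this] f]
  have "f (conv (\<lambda>r. P (s + r) (mild P s r x)) t) = integral {0..t} (\<lambda>r. f (Tp (t - r) (P (s + r) (mild P s r x))))"
    by (simp add: conv_def o_def)
  also have "\<dots> = conv (\<lambda>r. P (s + r) (f (mild P s r x))) t"
    unfolding conv_def by (intro integral_cong) (simp add: fT fP)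
  finally show "f (mild P s t x) = T t (f x) + conv (\<lambda>r. P (s + r) (f (mild P s r x))) t"
    using t mild_eq[of t s x] by (simp add: fT linear_add[OF bounded_linear.linear[OF f]])
qed (use \<tau> in auto)

lemma mild_max [simp]: "mild P s (max 0 \<tau>) x = mild P s \<tau> x"
  by (simp add: mild_def)

lemma mild_add: "mild P s \<tau> (x + y) = mild P s \<tau> x + mild P s \<tau> y"
proof -
  have "mild P s t x + mild P s t y = mild P s t (x + y)" if "t \<in> {0..max 0 \<tau>}" for t
  proof (rule mild_unique[where u = "\<lambda>t. mild P s t x + mild P s t y", OF _ _ that])
    show "continuous_on {0..max 0 \<tau>} (\<lambda>t. mild P s t x + mild P s t y)"
      by (intro mild_cont continuous_intros)
    fix t assume t: "t \<in> {0..max 0 \<tau>}"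
    have "conv (\<lambda>r. P (s + r) (mild P s r x + mild P s r y)) t =
        conv (\<lambda>r. P (s + r) (mild P s r x)) t + conv (\<lambda>r. P (s + r) (mild P s r y)) t"
      unfolding conv_def blinfun.add_right
      by (intro integral_add conv_integrable continuous_intros continuous_on_compose2[OF P] mild_cont) auto
    then show "mild P s t x + mild P s t y = T t (x + y) + conv (\<lambda>r. P (s + r) (mild P s r x + mild P s r y)) t"
      using t mild_eq[of t s x] mild_eq[of t s y] by (simp add: blinfun.add_right)
  qed
  from this[of "max 0 \<tau>"] show ?thesis by simp
qed

lemma mild_scaleR: "mild P s \<tau> (c *\<^sub>R x) = c *\<^sub>R mild P s \<tau> x"
  using mild_commute[of "\<lambda>x. c *\<^sub>R x" "max 0 \<tau>" s x]
  by (simp add: bounded_linear_scaleR_right blinfun.scaleR_right)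

lemma evol_apply: "evol P s \<tau> x = mild P s \<tau> x"
proof -
  obtain C where C: "C \<ge> 0" "\<And>s' \<tau>' x. \<bar>s'\<bar> \<le> \<bar>s\<bar> + \<bar>\<tau>\<bar> \<Longrightarrow> \<tau>' \<le> \<bar>s\<bar> + \<bar>\<tau>\<bar> \<Longrightarrow> norm (mild P s' \<tau>' x) \<le> C * norm x"
    using mild_bound[of "\<bar>s\<bar> + \<bar>\<tau>\<bar>"] by auto
  have "bounded_linear (mild P s \<tau>)"
    by (rule bounded_linear_intro[where K = C]) (use C(2)[of s \<tau>] in \<open>auto simp: mild_add mild_scaleR mult.commute\<close>)
  then show ?thesis by (simp add: evol_def bounded_linear_Blinfun_apply)
qed

lemma evol_bound:
  assumes N: "N \<ge> 0"
  obtains C where "C \<ge> 0" "\<And>s \<tau>. \<bar>s\<bar> \<le> N \<Longrightarrow> \<tau> \<le> N \<Longrightarrow> norm (evol P s \<tau>) \<le> C"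
proof -
  obtain C where C: "C \<ge> 0" "\<And>s \<tau> x. \<bar>s\<bar> \<le> N \<Longrightarrow> \<tau> \<le> N \<Longrightarrow> norm (mild P s \<tau> x) \<le> C * norm x"
    using mild_bound[OF N] by metis
  then have "norm (evol P s \<tau>) \<le> C" if "\<bar>s\<bar> \<le> N" "\<tau> \<le> N" for s \<tau>
    using that by (intro norm_blinfun_bound) (auto simp: evol_apply)
  with C(1) show ?thesis using that by blast
qed

lemma strongly_cont_evol: "strongly_cont (\<lambda>z. evol P (fst z) (snd z))"
  unfolding strongly_cont_def evol_apply
proof (intro conjI allI mild_cont continuous_intros)
  fix z :: "real \<times> real"
  define N where "N = \<bar>fst z\<bar> + \<bar>snd z\<bar> + 1"
  obtain C where C: "C \<ge> 0" "\<And>s \<tau>. \<bar>s\<bar> \<le> N \<Longrightarrow> \<tau> \<le> N \<Longrightarrow> norm (evol P s \<tau>) \<le> C"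
    using evol_bound[of N] by (auto simp: N_def)
  have "\<forall>\<^sub>F w in nhds z. w \<in> {- N<..<N} \<times> {- N<..<N}"
    by (rule eventually_nhds_in_open) (auto simp: N_def open_Times mem_Times_iff)
  then have "\<forall>\<^sub>F w in nhds z. norm (evol P (fst w) (snd w)) \<le> C"
    by eventually_elim (rule C(2), auto)
  then show "\<exists>c. \<forall>\<^sub>F w in nhds z. norm (evol P (fst w) (snd w)) \<le> c" by blast
qed

lemma evol_cont [continuous_intros]:
  assumes "continuous_on S f" "continuous_on S g" "continuous_on S v"
  shows "continuous_on S (\<lambda>z. evol P (f z) (g z) (v z))"
  using strongly_cont_apply[OF strongly_cont_evol continuous_on_Pair[OF assms(1,2)] assms(3)] by simp

lemma evol_eq:
  "\<tau> \<ge> 0 \<Longrightarrow> evol P s \<tau> x = T \<tau> x + conv (\<lambda>r. P (s + r) (evol P s r x)) \<tau>"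
  unfolding evol_apply by (rule mild_eq)

lemma evol_0: "evol P s 0 = id_blinfun"
  by (rule blinfun_eqI) (simp add: evol_eq conv_def T_0)

text \<open>By \<open>mild_shift\<close>, the solution after time \<open>\<sigma>\<close> solves the
  equation restarted at \<open>s + \<sigma>\<close> from its current value.\<close>

lemma evol_evol:
  assumes "\<sigma> \<ge> 0" "\<tau> \<ge> 0"
  shows "evol P (s + \<sigma>) \<tau> (evol P s \<sigma> x) = evol P s (\<sigma> + \<tau>) x"
proof -
  have "evol P s (\<sigma> + \<tau>) x = mild P (s + \<sigma>) \<tau> (evol P s \<sigma> x)"
  proof (rule mild_unique[where u = "\<lambda>\<tau>. evol P s (\<sigma> + \<tau>) x" and N = \<tau>])
    show "continuous_on {0..\<tau>} (\<lambda>\<tau>. evol P s (\<sigma> + \<tau>) x)" by (intro continuous_intros)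
    fix t assume t: "t \<in> {0..\<tau>}"
    have "continuous_on UNIV (\<lambda>r. P (s + r) (evol P s r x))"
      by (intro continuous_intros continuous_on_compose2[OF P]) auto
    from mild_shift[OF this, of \<sigma> t x]
    show "evol P s (\<sigma> + t) x = T t (evol P s \<sigma> x) + conv (\<lambda>r. P (s + \<sigma> + r) (evol P s (\<sigma> + r) x)) t"
      using t assms evol_eq[of \<sigma> s x] evol_eq[of "\<sigma> + t" s x] by (simp add: add.assoc)
  qed (use assms in auto)
  then show ?thesis by (simp add: evol_apply)
qed

text \<open>For \<open>\<tau> = \<sigma> + \<delta>\<close> the cocycle law gives U(t, \<tau>) x -
  U(t, \<sigma>) x = - U(t, \<tau>) (U(\<tau>, \<sigma>) x - x). The integral equation and
  \<open>gen_imp_T_diff\<close> write the inner increment as an integral over an interval of length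
  \<open>\<delta>\<close>. Only \<open>x\<close> itself has to be in the domain.\<close>

lemma evol_initial_time_derivative:
  assumes g: "gen x y" and s: "s \<in> {a..t}"
  shows "((\<lambda>\<sigma>. evol P \<sigma> (t - \<sigma>) x) has_vector_derivative - evol P s (t - s) (y + P s x)) (at s within {a..t})"
proof -
  define k where "k = (\<lambda>\<sigma> \<delta> r. - evol P (\<sigma> + \<delta>) (t - \<sigma> - \<delta>)
     (Tp r y + Tp (\<delta> - r) (P (\<sigma> + r) (evol P \<sigma> r x))))"
  have "((\<lambda>\<sigma>. evol P \<sigma> (t - \<sigma>) x) has_vector_derivative k s 0 0) (at s within {a..t})"
  proof (rule has_vector_derivative_from_increments[where k = k, OF _ _ s])
    show "continuous_on UNIV (\<lambda>z. k (fst z) (fst (snd z)) (snd (snd z)))"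
      unfolding k_def by (intro continuous_intros continuous_on_compose2[OF P]) auto
    fix \<sigma> \<tau> assume st: "a \<le> \<sigma>" "\<sigma> \<le> \<tau>" "\<tau> \<le> t"
    define \<delta> where "\<delta> = \<tau> - \<sigma>"
    have \<delta>: "\<delta> \<ge> 0" "\<tau> = \<sigma> + \<delta>" using st by (auto simp: \<delta>_def)
    have int: "(\<lambda>r. Tp (\<delta> - r) (P (\<sigma> + r) (evol P \<sigma> r x))) integrable_on {0..\<delta>}"
      by (intro conv_integrable continuous_intros continuous_on_compose2[OF P]) auto
    have "evol P \<sigma> \<delta> x - x = (T \<delta> x - x) + conv (\<lambda>r. P (\<sigma> + r) (evol P \<sigma> r x)) \<delta>"
      using \<delta> by (simp add: evol_eq)
    also have "\<dots> = integral {0..\<delta>} (\<lambda>r. Tp r y + Tp (\<delta> - r) (P (\<sigma> + r) (evol P \<sigma> r x)))"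
      unfolding gen_imp_T_diff[OF g \<delta>(1)] intT_apply conv_def
      by (rule integral_add[symmetric, OF Tp_integrable int])
    finally have inc: "evol P \<sigma> \<delta> x - x = integral {0..\<delta>} (\<lambda>r. Tp r y + Tp (\<delta> - r) (P (\<sigma> + r) (evol P \<sigma> r x)))" .
    have "evol P \<tau> (t - \<tau>) x - evol P \<sigma> (t - \<sigma>) x = - evol P \<tau> (t - \<tau>) (evol P \<sigma> \<delta> x - x)"
      using evol_evol[of \<delta> "t - \<tau>" \<sigma> x] \<delta> st by (simp add: blinfun.diff_right)
    also have "\<dots> = integral {0..\<delta>} (\<lambda>r. - evol P \<tau> (t - \<tau>) (Tp r y + Tp (\<delta> - r) (P (\<sigma> + r) (evol P \<sigma> r x))))"
      unfolding inc using integral_linear[OF integrable_add[OF Tp_integrable int] blinfun.bounded_linear_right[of "evol P \<tau> (t - \<tau>)"]]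
      by (simp add: o_def)
    finally show "evol P \<tau> (t - \<tau>) x - evol P \<sigma> (t - \<sigma>) x = integral {0..\<tau> - \<sigma>} (k \<sigma> (\<tau> - \<sigma>))"
      unfolding k_def \<delta>_def[symmetric] using \<delta> by (simp add: algebra_simps)
  qed
  moreover have "k s 0 0 = - evol P s (t - s) (y + P s x)" by (simp add: k_def T_0 evol_0)
  ultimately show ?thesis by simp
qed

end

text \<open>Formally w' = A w + h. After applying \<open>R\<close>, the unbounded term becomes A R w
  = \<mu> R w - w, so the smoothed mild solution is differentiable in the ordinary sense.\<close>

lemma resolvent_mild_derivative:
  fixes R :: "'a \<Rightarrow>\<^sub>L 'a"
  assumes res: "is_resolvent \<mu> R"
    and w: "continuous_on UNIV w" and h: "continuous_on UNIV h"
    and eq: "\<And>\<tau>. \<tau> \<in> {0..N} \<Longrightarrow> w \<tau> = T \<tau> w0 + conv h \<tau>" and t: "t \<in> {0..N}"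
  shows "((\<lambda>\<tau>. R (w \<tau>)) has_vector_derivative \<mu> *\<^sub>R R (w t) - w t + R (h t)) (at t within {0..N})"
proof -
  have R: "gen (R x) (\<mu> *\<^sub>R R x - x)" for x using res by (simp add: is_resolvent_def)
  define k where "k = (\<lambda>\<sigma> \<delta> r. Tp r (\<mu> *\<^sub>R R (w \<sigma>) - w \<sigma>) + R (Tp (\<delta> - r) (h (\<sigma> + r))))"
  have "((\<lambda>\<tau>. R (w \<tau>)) has_vector_derivative k t 0 0) (at t within {0..N})"
  proof (rule has_vector_derivative_from_increments[where k = k, OF _ _ t])
    show "continuous_on UNIV (\<lambda>z. k (fst z) (fst (snd z)) (snd (snd z)))"
      unfolding k_def by (intro continuous_intros continuous_on_compose2[OF w] continuous_on_compose2[OF h]) auto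
    fix \<sigma> \<tau> assume st: "0 \<le> \<sigma>" "\<sigma> \<le> \<tau>" "\<tau> \<le> N"
    define \<delta> where "\<delta> = \<tau> - \<sigma>"
    have \<delta>: "\<delta> \<ge> 0" "\<tau> = \<sigma> + \<delta>" using st by (auto simp: \<delta>_def)
    have int: "(\<lambda>r. Tp (\<delta> - r) (h (\<sigma> + r))) integrable_on {0..\<delta>}"
      by (intro conv_integrable continuous_intros continuous_on_compose2[OF h]) auto
    note Rint = integrable_linear[OF int blinfun.bounded_linear_right[of R], unfolded o_def]
    have "w \<tau> = T \<delta> (w \<sigma>) + conv (\<lambda>r. h (\<sigma> + r)) \<delta>"
      using mild_shift[OF h, of \<sigma> \<delta> w0] eq[of \<sigma>] eq[of \<tau>] \<delta> st by simp
    moreover have "R (T \<delta> (w \<sigma>)) = T \<delta> (R (w \<sigma>))" by (rule is_resolvent_T[OF res \<delta>(1)])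
    ultimately have "R (w \<tau>) - R (w \<sigma>) = (T \<delta> (R (w \<sigma>)) - R (w \<sigma>)) + R (conv (\<lambda>r. h (\<sigma> + r)) \<delta>)"
      by (simp add: blinfun.add_right)
    also have "\<dots> = integral {0..\<delta>} (\<lambda>r. Tp r (\<mu> *\<^sub>R R (w \<sigma>) - w \<sigma>)) + integral {0..\<delta>} (\<lambda>r. R (Tp (\<delta> - r) (h (\<sigma> + r))))"
      unfolding gen_imp_T_diff[OF R \<delta>(1)] intT_apply conv_def
      using integral_linear[OF int blinfun.bounded_linear_right[of R]] by (simp add: o_def)
    also have "\<dots> = integral {0..\<delta>} (k \<sigma> \<delta>)"
      unfolding k_def by (rule integral_add[symmetric, OF Tp_integrable Rint])
    finally show "R (w \<tau>) - R (w \<sigma>) = integral {0..\<tau> - \<sigma>} (k \<sigma> (\<tau> - \<sigma>))" by (simp add: \<delta>_def)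
  qed
  then show ?thesis by (simp add: k_def T_0)
qed

end

section \<open>Differentiability in the final time\<close>

lemma has_vector_derivative_iff_quotient:
  fixes F :: "real \<Rightarrow> 'a::real_normed_vector"
  shows "(F has_vector_derivative y) (at t within S) \<longleftrightarrow>
     ((\<lambda>r. (1 / (r - t)) *\<^sub>R (F r - F t)) \<longlongrightarrow> y) (at t within S)"
proof -
  have "((\<lambda>r. (1 / norm (r - t)) *\<^sub>R (F r - (F t + (r - t) *\<^sub>R y))) \<longlongrightarrow> 0) (at t within S) \<longleftrightarrow>
      ((\<lambda>r. norm ((1 / norm (r - t)) *\<^sub>R (F r - (F t + (r - t) *\<^sub>R y)))) \<longlongrightarrow> 0) (at t within S)"
    by (rule tendsto_norm_zero_iff[symmetric])
  also have "\<dots> \<longleftrightarrow> ((\<lambda>r. norm ((1 / (r - t)) *\<^sub>R (F r - F t) - y)) \<longlongrightarrow> 0) (at t within S)"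
  proof (rule filterlim_cong[OF refl refl])
    have "norm ((1 / norm (r - t)) *\<^sub>R (F r - (F t + (r - t) *\<^sub>R y))) = norm ((1 / (r - t)) *\<^sub>R (F r - F t) - y)"
      if "r \<noteq> t" for r
    proof -
      have "(1 / (r - t)) *\<^sub>R (F r - F t) - y = (1 / (r - t)) *\<^sub>R (F r - (F t + (r - t) *\<^sub>R y))"
        using that by (simp add: scaleR_diff_right scaleR_add_right)
      then show ?thesis by simp
    qed
    then show "\<forall>\<^sub>F r in at t within S. norm ((1 / norm (r - t)) *\<^sub>R (F r - (F t + (r - t) *\<^sub>R y))) =
        norm ((1 / (r - t)) *\<^sub>R (F r - F t) - y)"
      by (auto simp: eventually_at_filter)
  qed
  also have "\<dots> \<longleftrightarrow> ((\<lambda>r. (1 / (r - t)) *\<^sub>R (F r - F t)) \<longlongrightarrow> y) (at t within S)"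
    unfolding tendsto_norm_zero_iff by (rule Lim_null[symmetric])
  finally show ?thesis
    unfolding has_vector_derivative_def has_derivative_within by (simp add: bounded_linear_scaleR_left)
qed

text \<open>
  \<open>B\<close> itself need not be differentiable: its increments are only evaluated at \<open>v r\<close>, where they
  are those of \<open>Q\<close>.
\<close>

lemma has_vector_derivative_smoothed_apply:
  fixes B Q :: "real \<Rightarrow> 'a::real_normed_vector \<Rightarrow>\<^sub>L 'a" and v Y :: "real \<Rightarrow> 'a"
  assumes Q: "(Q has_vector_derivative D) (at t within S)"
    and Y: "continuous_on S Y" and v: "(v has_vector_derivative v') (at t within S)"
    and BQ: "\<And>r r'. r \<in> S \<Longrightarrow> r' \<in> S \<Longrightarrow> B r (v r') = Q r (Y r')" and t: "t \<in> S"
  shows "((\<lambda>r. B r (v r)) has_vector_derivative D (Y t) + B t v') (at t within S)"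
  unfolding has_vector_derivative_iff_quotient
proof -
  have "((\<lambda>r. ((1 / (r - t)) *\<^sub>R (Q r - Q t)) (Y r) + B t ((1 / (r - t)) *\<^sub>R (v r - v t)))
      \<longlongrightarrow> D (Y t) + B t v') (at t within S)"
    using Q v Y t unfolding has_vector_derivative_iff_quotient continuous_on_def
    by (intro tendsto_intros) auto
  moreover have "\<forall>\<^sub>F r in at t within S. ((1 / (r - t)) *\<^sub>R (Q r - Q t)) (Y r) + B t ((1 / (r - t)) *\<^sub>R (v r - v t)) =
      (1 / (r - t)) *\<^sub>R (B r (v r) - B t (v t))"
    unfolding eventually_at_filter
    using t by (auto simp: BQ blinfun.scaleR_left blinfun.scaleR_right blinfun.diff_left blinfun.diff_right
        simp flip: scaleR_add_right)
  ultimately show "((\<lambda>r. (1 / (r - t)) *\<^sub>R (B r (v r) - B t (v t))) \<longlongrightarrow> D (Y t) + B t v') (at t within S)"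
    by (rule Lim_transform_eventually)
qed

context strongly_continuous_semigroup
begin

lemma Tp_gen_derivative:
  assumes "gen z y" "t \<in> {0..N}"
  shows "((\<lambda>t. Tp t z) has_vector_derivative Tp t y) (at t within {0..N})"
proof -
  have "((\<lambda>t. z + intT t y) has_vector_derivative 0 + Tp t y) (at t within {0..N})"
    unfolding intT_apply
    by (intro derivative_intros integral_has_vector_derivative) (use assms in \<open>auto intro!: continuous_intros\<close>)
  then have "((\<lambda>t. z + intT t y) has_vector_derivative Tp t y) (at t within {0..N})" by simp
  then show ?thesis
  proof (rule has_vector_derivative_transform[rotated 2])
    show "Tp r z = z + intT r y" if "r \<in> {0..N}" for r
      using gen_imp_T_diff[OF assms(1), of r] that by (simp add: algebra_simps)
  qed (use assms in auto)
qed

lemma Tp_reflected_derivative: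
  assumes v: "(v has_vector_derivative v') (at r within {0..\<tau>})" and g: "gen (v r) y" and r: "r \<in> {0..\<tau>}"
  shows "((\<lambda>r. Tp (\<tau> - r) (v r)) has_vector_derivative Tp (\<tau> - r) (v' - y)) (at r within {0..\<tau>})"
proof -
  have im: "(\<lambda>r. \<tau> - r) ` {0..\<tau>} = {0..\<tau>}" by (auto simp: image_iff intro: bexI[of _ "\<tau> - _"])
  have "((\<lambda>t. Tp t (v r)) \<circ> (\<lambda>r. \<tau> - r) has_vector_derivative (- 1) *\<^sub>R Tp (\<tau> - r) y) (at r within {0..\<tau>})"
  proof (rule vector_diff_chain_within)
    show "((\<lambda>r. \<tau> - r) has_vector_derivative - 1) (at r within {0..\<tau>})"
      by (auto intro!: derivative_eq_intros)
    show "((\<lambda>t. Tp t (v r)) has_vector_derivative Tp (\<tau> - r) y) (at (\<tau> - r) within (\<lambda>r. \<tau> - r) ` {0..\<tau>})"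
      unfolding im by (rule Tp_gen_derivative[OF g]) (use r in auto)
  qed
  then have 1: "((\<lambda>q. (1 / (q - r)) *\<^sub>R (Tp (\<tau> - q) (v r) - Tp (\<tau> - r) (v r))) \<longlongrightarrow> - Tp (\<tau> - r) y) (at r within {0..\<tau>})"
    by (simp add: has_vector_derivative_iff_quotient o_def)
  obtain c where c: "\<forall>\<^sub>F s in nhds (\<tau> - r). norm (Tp s) \<le> c"
    using strongly_cont_Tp unfolding strongly_cont_def by blast
  have "continuous_on UNIV (\<lambda>t. Tp t v')" by (intro continuous_intros)
  then have sc: "((\<lambda>t. Tp t v') \<longlongrightarrow> Tp (\<tau> - r) v') (nhds (\<tau> - r))"
    using tendsto_at_iff_tendsto_nhds[of "\<lambda>t. Tp t v'" "\<tau> - r"] by (simp add: continuous_on_def)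
  have lim: "((\<lambda>q. \<tau> - q) \<longlongrightarrow> \<tau> - r) (at r within {0..\<tau>})" by (intro tendsto_intros)
  have 2: "((\<lambda>q. Tp (\<tau> - q) ((1 / (q - r)) *\<^sub>R (v q - v r))) \<longlongrightarrow> Tp (\<tau> - r) v') (at r within {0..\<tau>})"
    by (rule tendsto_strong_apply[OF c sc lim]) (use v in \<open>simp add: has_vector_derivative_iff_quotient\<close>)
  have "(1 / (q - r)) *\<^sub>R (Tp (\<tau> - q) (v q) - Tp (\<tau> - r) (v r)) =
      Tp (\<tau> - q) ((1 / (q - r)) *\<^sub>R (v q - v r)) + (1 / (q - r)) *\<^sub>R (Tp (\<tau> - q) (v r) - Tp (\<tau> - r) (v r))" for q
    by (simp add: blinfun.scaleR_right blinfun.diff_right flip: scaleR_add_right)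
  then show ?thesis
    unfolding has_vector_derivative_iff_quotient using tendsto_add[OF 2 1]
    by (simp add: blinfun.diff_right)
qed

text \<open>
  With \<open>\<A> r = A + P (s + r)\<close>, the derivative \<open>f\<close> of \<open>u \<tau> = evol P s \<tau> x\<close> should solve
  \<open>f' = \<A> f + P' u\<close>, where \<open>P' u = D (\<mu> u - A u) = D (\<mu> u + P u - f)\<close> only involves bounded
  operators. The mild solution \<open>f\<close> of this equation exists; \<open>v = x + \<integral> f\<close> is of the form \<open>R Y\<close>,
  and \<open>d = u - v\<close> and \<open>e = v' - \<A> v\<close> satisfy a homogeneous Volterra system, hence vanish.
\<close>

lemma evol_final_time_derivative:
  fixes P D :: "real \<Rightarrow> 'a \<Rightarrow>\<^sub>L 'a" and R :: "'a \<Rightarrow>\<^sub>L 'a"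
  assumes P: "continuous_on UNIV P" and res: "is_resolvent \<mu> R" and N: "N \<ge> 0"
    and D: "continuous_on {0..N} D"
    and Q: "\<And>r. r \<in> {0..N} \<Longrightarrow> ((\<lambda>r. P (s + r) o\<^sub>L R) has_vector_derivative D r) (at r within {0..N})"
    and g: "gen x y"
  obtains f where "f 0 = y + P s x"
    "\<And>\<tau>. \<tau> \<in> {0..N} \<Longrightarrow> ((\<lambda>\<tau>. evol P s \<tau> x) has_vector_derivative f \<tau>) (at \<tau> within {0..N})"
proof -
  define \<beta> where "\<beta> = (\<lambda>r. P (s + r))"
  \<comment> \<open>\<open>D\<close> is controlled only on \<open>{0..N}\<close>; clamping the
    argument gives a continuous function on the line, as the Volterra theory requires.\<close>
  define E where "E = (\<lambda>r. D (max 0 (min N r)))"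
  define u where "u = (\<lambda>\<tau>. evol P s \<tau> x)"
  have \<beta>: "continuous_on S \<beta>" for S
    unfolding \<beta>_def by (intro continuous_on_compose2[OF P] continuous_intros) auto
  have E: "continuous_on S E" for S
    unfolding E_def by (intro continuous_on_compose2[OF D] continuous_intros) (use N in auto)
  have u: "continuous_on S u" for S
    unfolding u_def by (intro evol_cont[OF P] continuous_intros)
  have ED: "E r = D r" if "r \<in> {0..N}" for r using that by (simp add: E_def)
  \<comment> \<open>The preimage of \<open>x\<close> under \<open>R\<close>; \<open>f0\<close> below
    is the value that the derivative should have at elapsed time \<open>0\<close>.\<close>
  define y0 where "y0 = \<mu> *\<^sub>R x - y"
  define f0 where "f0 = y + \<beta> 0 x"
  have Ry0: "R y0 = x" using res g by (simp add: is_resolvent_def y0_def)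
  \<comment> \<open>The formal equation f' = A f + \<beta> f + D (\<mu> u + \<beta> u - f) is
    regrouped: \<open>g\<close> collects the terms in the known \<open>u\<close>, and
    \<open>G = \<beta> - E\<close> acts on the unknown \<open>f\<close>.\<close>
  define g where "g = (\<lambda>r. E r (\<mu> *\<^sub>R u r + \<beta> r (u r)))"
  have g: "continuous_on S g" for S unfolding g_def by (intro continuous_intros E u \<beta>)
  \<comment> \<open>With the identity as kernel, \<open>volterra_op\<close> is the plain convolution
    of the semigroup with \<open>g\<close>, so its continuity is already available. The initial time
    is a dummy \<open>0\<close>.\<close>
  define \<phi> where "\<phi> = (\<lambda>z :: real \<times> real. Tp (snd z) f0 + volterra_op (\<lambda>_. id_blinfun) (\<lambda>z. g (snd z)) (0, snd z))"
  have gs: "continuous_on UNIV (\<lambda>z :: real \<times> real. g (snd z))"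
    by (intro continuous_on_compose2[OF g] continuous_intros) auto
  have \<phi>: "continuous_on UNIV \<phi>"
    unfolding \<phi>_def
    by (intro continuous_intros continuous_on_compose2[OF volterra_op_cont[OF continuous_on_const gs]]) auto
  define G where "G = (\<lambda>r. \<beta> r - E r)"
  have G: "continuous_on UNIV G" unfolding G_def by (intro continuous_intros E \<beta>)
  define f where "f = (\<lambda>\<tau>. volterra G \<phi> (0, \<tau>))"
  have f: "continuous_on S f" for S
    unfolding f_def by (intro continuous_on_compose2[OF volterra_cont[OF G \<phi>]] continuous_intros) auto
  define h where "h = (\<lambda>r. g r + G r (f r))"
  have h: "continuous_on S h" for S
    unfolding h_def by (intro continuous_intros g f continuous_on_subset[OF G]) auto
  have f_eq: "f \<tau> = T \<tau> f0 + conv h \<tau>" if \<tau>: "\<tau> \<ge> 0" for \<tau>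
  proof -
    have "f \<tau> = T \<tau> f0 + (integral {0..\<tau>} (\<lambda>r. Tp (\<tau> - r) (g r)) + integral {0..\<tau>} (\<lambda>r. Tp (\<tau> - r) (G r (f r))))"
      using volterra_eq[OF G \<phi>, of "(0, \<tau>)"] \<tau> by (simp add: f_def \<phi>_def volterra_op_eq)
    also have "\<dots> = T \<tau> f0 + integral {0..\<tau>} (\<lambda>r. Tp (\<tau> - r) (g r) + Tp (\<tau> - r) (G r (f r)))"
      by (subst integral_add[symmetric])
         (intro conv_integrable continuous_intros g f continuous_on_subset[OF G] subset_UNIV refl)+
    finally show ?thesis by (simp add: conv_def h_def blinfun.add_right)
  qed
  have f_0: "f 0 = f0" using f_eq[of 0] by (simp add: conv_def T_0)
  define \<Phi> where "\<Phi> = (\<lambda>\<tau>. integral {0..\<tau>} f)"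
  define H where "H = (\<lambda>\<tau>. integral {0..\<tau>} h)"
  have \<Phi>': "(\<Phi> has_vector_derivative f \<tau>) (at \<tau> within {0..N})" if "\<tau> \<in> {0..N}" for \<tau>
    unfolding \<Phi>_def by (rule integral_has_vector_derivative[OF f that])
  have H': "(H has_vector_derivative h \<tau>) (at \<tau> within {0..N})" if "\<tau> \<in> {0..N}" for \<tau>
    unfolding H_def by (rule integral_has_vector_derivative[OF h that])
  have \<Phi>_0: "\<Phi> 0 = 0" and H_0: "H 0 = 0" by (simp_all add: \<Phi>_def H_def)
  \<comment> \<open>Integrating (R f)' = \<mu> R f - f + R h gives R f - R f0 = \<mu> R \<Phi> -
    \<Phi> + R H. Solved for \<Phi>, this exhibits x + \<Phi> as \<open>R\<close> applied to
    \<open>Y\<close>.\<close>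
  define Y where "Y = (\<lambda>\<tau>. y0 + \<mu> *\<^sub>R \<Phi> \<tau> + H \<tau> - f \<tau> + f0)"
  define v where "v = (\<lambda>\<tau>. x + \<Phi> \<tau>)"
  note blin = bounded_linear.has_vector_derivative[OF blinfun.bounded_linear_right]
  have vY: "v \<tau> = R (Y \<tau>)" if \<tau>: "\<tau> \<in> {0..N}" for \<tau>
  proof -
    define Z where "Z = (\<lambda>\<tau>. R (f \<tau>) - (\<mu> *\<^sub>R R (\<Phi> \<tau>) - \<Phi> \<tau> + R (H \<tau>)))"
    have "(Z has_vector_derivative 0) (at t within {0..\<tau>})" if t: "t \<in> {0..\<tau>}" for t
    proof -
      have tN: "t \<in> {0..N}" using t \<tau> by auto
      have "((\<lambda>\<tau>. R (f \<tau>)) has_vector_derivative \<mu> *\<^sub>R R (f t) - f t + R (h t)) (at t within {0..N})"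
        by (rule resolvent_mild_derivative[OF res f h _ tN]) (use f_eq in auto)
      then have "(Z has_vector_derivative (\<mu> *\<^sub>R R (f t) - f t + R (h t)) - (\<mu> *\<^sub>R R (f t) - f t + R (h t)))
          (at t within {0..N})"
        unfolding Z_def
        by (intro has_vector_derivative_diff has_vector_derivative_add blin \<Phi>' H' tN
            bounded_linear.has_vector_derivative[OF bounded_linear_scaleR_right])
      then show ?thesis using \<tau> by (auto elim!: has_vector_derivative_within_subset)
    qed
    then have "((\<lambda>_. 0) has_integral (Z \<tau> - Z 0)) {0..\<tau>}"
      using \<tau> by (intro fundamental_theorem_of_calculus) auto
    then have "Z \<tau> = Z 0" using has_integral_unique[OF has_integral_0] by fastforce
    then have "R (f \<tau>) - (\<mu> *\<^sub>R R (\<Phi> \<tau>) - \<Phi> \<tau> + R (H \<tau>)) = R f0"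
      by (simp add: Z_def \<Phi>_0 H_0 f_0)
    then show ?thesis
      by (simp add: v_def Y_def blinfun.add_right blinfun.diff_right blinfun.scaleR_right Ry0 algebra_simps)
  qed
  have \<Phi>: "continuous_on {0..N} \<Phi>" using \<Phi>' by (rule continuous_on_vector_derivative)
  have H: "continuous_on {0..N} H" using H' by (rule continuous_on_vector_derivative)
  have Y: "continuous_on {0..N} Y" unfolding Y_def by (intro continuous_intros \<Phi> H f)
  have v: "continuous_on {0..N} v" unfolding v_def by (intro continuous_intros \<Phi>)
  have v': "(v has_vector_derivative f \<tau>) (at \<tau> within {0..N})" if "\<tau> \<in> {0..N}" for \<tau>
    using has_vector_derivative_add[OF has_vector_derivative_const \<Phi>'[OF that]] by (simp add: v_def)
  \<comment> \<open>This is the defect f - A v - \<beta> v with A v = \<mu> v - Y. Substituting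
    \<open>Y\<close> cancels \<open>f\<close> and the \<mu> terms; what is left is visibly
    differentiable, which \<open>f\<close> need not be.\<close>
  define e where "e = (\<lambda>\<tau>. H \<tau> + \<beta> 0 x - \<beta> \<tau> (v \<tau>))"
  have f_e: "f \<tau> = e \<tau> + \<mu> *\<^sub>R v \<tau> - Y \<tau> + \<beta> \<tau> (v \<tau>)" for \<tau>
    by (simp add: e_def v_def Y_def y0_def f0_def algebra_simps)
  define d where "d = (\<lambda>\<tau>. u \<tau> - v \<tau>)"
  have d: "continuous_on {0..N} d" unfolding d_def by (intro continuous_intros u v)
  have \<beta>v': "((\<lambda>r. \<beta> r (v r)) has_vector_derivative D \<tau> (Y \<tau>) + \<beta> \<tau> (f \<tau>)) (at \<tau> within {0..N})"
    if \<tau>: "\<tau> \<in> {0..N}" for \<tau>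
    by (rule has_vector_derivative_smoothed_apply[OF Q[OF \<tau>] Y v'[OF \<tau>] _ \<tau>]) (simp add: \<beta>_def vY)
  have e': "(e has_vector_derivative D \<tau> (\<mu> *\<^sub>R d \<tau> + \<beta> \<tau> (d \<tau>) - e \<tau>)) (at \<tau> within {0..N})"
    if \<tau>: "\<tau> \<in> {0..N}" for \<tau>
  proof -
    have "(e has_vector_derivative (h \<tau> + 0) - (D \<tau> (Y \<tau>) + \<beta> \<tau> (f \<tau>))) (at \<tau> within {0..N})"
      unfolding e_def
      by (intro has_vector_derivative_diff has_vector_derivative_add H' \<beta>v' \<tau> has_vector_derivative_const)
    \<comment> \<open>The terms \<open>\<beta> \<tau> (f \<tau>)\<close> cancel. This is where the
      choice of the equation for \<open>f\<close> pays off: only \<open>D\<close> remains, and its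
      argument is linear in \<open>d\<close> and \<open>e\<close>.\<close>
    moreover have "(h \<tau> + 0) - (D \<tau> (Y \<tau>) + \<beta> \<tau> (f \<tau>)) = D \<tau> (\<mu> *\<^sub>R u \<tau> + \<beta> \<tau> (u \<tau>) - f \<tau> - Y \<tau>)"
      by (simp add: h_def g_def G_def ED[OF \<tau>] blinfun.diff_left blinfun.diff_right blinfun.add_right)
    moreover have "\<mu> *\<^sub>R u \<tau> + \<beta> \<tau> (u \<tau>) - f \<tau> - Y \<tau> = \<mu> *\<^sub>R d \<tau> + \<beta> \<tau> (d \<tau>) - e \<tau>"
      by (simp add: f_e d_def blinfun.diff_right algebra_simps)
    ultimately show ?thesis by simp
  qed
  then have e: "continuous_on {0..N} e" by (rule continuous_on_vector_derivative)
  have e_int: "e \<tau> = integral {0..\<tau>} (\<lambda>r. E r (\<mu> *\<^sub>R d r + \<beta> r (d r) - e r))" if \<tau>: "\<tau> \<in> {0..N}" for \<tau>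
  proof -
    have "((\<lambda>r. E r (\<mu> *\<^sub>R d r + \<beta> r (d r) - e r)) has_integral e \<tau> - e 0) {0..\<tau>}"
    proof (rule fundamental_theorem_of_calculus)
      fix t assume "t \<in> {0..\<tau>}"
      then have t: "t \<in> {0..N}" using \<tau> by auto
      show "(e has_vector_derivative E t (\<mu> *\<^sub>R d t + \<beta> t (d t) - e t)) (at t within {0..\<tau>})"
        unfolding ED[OF t] by (rule has_vector_derivative_within_subset[OF e'[OF t]]) (use \<tau> in auto)
    qed (use \<tau> in auto)
    moreover have "e 0 = 0" by (simp add: e_def v_def \<Phi>_0 H_0)
    ultimately show ?thesis by (simp add: integral_unique)
  qed
  \<comment> \<open>Since \<open>v\<close> takes values in the domain, it satisfies variation of
    constants with forcing e + \<beta> v; subtract this from the integral equation of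
    \<open>u\<close>.\<close>
  have d_int: "d \<tau> = conv (\<lambda>r. \<beta> r (d r) - e r) \<tau>" if \<tau>: "\<tau> \<in> {0..N}" for \<tau>
  proof -
    have sub: "continuous_on {0..\<tau>} v" "continuous_on {0..\<tau>} e"
      using \<tau> by (auto intro: continuous_on_subset[OF v] continuous_on_subset[OF e])
    have "((\<lambda>r. Tp (\<tau> - r) (e r + \<beta> r (v r))) has_integral Tp (\<tau> - \<tau>) (v \<tau>) - Tp (\<tau> - 0) (v 0)) {0..\<tau>}"
    proof (rule fundamental_theorem_of_calculus)
      fix r assume r: "r \<in> {0..\<tau>}"
      then have rN: "r \<in> {0..N}" using \<tau> by auto
      have "gen (v r) (\<mu> *\<^sub>R v r - Y r)" using res vY[OF rN] by (simp add: is_resolvent_def)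
      moreover have "(v has_vector_derivative f r) (at r within {0..\<tau>})"
        by (rule has_vector_derivative_within_subset[OF v'[OF rN]]) (use \<tau> in auto)
      ultimately have "((\<lambda>r. Tp (\<tau> - r) (v r)) has_vector_derivative Tp (\<tau> - r) (f r - (\<mu> *\<^sub>R v r - Y r))) (at r within {0..\<tau>})"
        using Tp_reflected_derivative r by blast
      then show "((\<lambda>r. Tp (\<tau> - r) (v r)) has_vector_derivative Tp (\<tau> - r) (e r + \<beta> r (v r))) (at r within {0..\<tau>})"
        by (simp add: f_e algebra_simps)
    qed (use \<tau> in auto)
    then have "v \<tau> - T \<tau> x = integral {0..\<tau>} (\<lambda>r. Tp (\<tau> - r) (e r + \<beta> r (v r)))"
      using \<tau> by (simp add: integral_unique T_0 v_def \<Phi>_0)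
    moreover have "u \<tau> - T \<tau> x = integral {0..\<tau>} (\<lambda>r. Tp (\<tau> - r) (\<beta> r (u r)))"
      using evol_eq[OF P, of \<tau> s x] \<tau> by (simp add: u_def conv_def \<beta>_def)
    moreover have "integral {0..\<tau>} (\<lambda>r. Tp (\<tau> - r) (\<beta> r (u r))) - integral {0..\<tau>} (\<lambda>r. Tp (\<tau> - r) (e r + \<beta> r (v r)))
        = integral {0..\<tau>} (\<lambda>r. Tp (\<tau> - r) (\<beta> r (u r)) - Tp (\<tau> - r) (e r + \<beta> r (v r)))"
      by (rule integral_diff[symmetric]) (intro conv_integrable continuous_intros \<beta> u sub)+
    moreover have "Tp (\<tau> - r) (\<beta> r (u r)) - Tp (\<tau> - r) (e r + \<beta> r (v r)) = Tp (\<tau> - r) (\<beta> r (d r) - e r)" for r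
      by (simp add: d_def blinfun.diff_right blinfun.add_right algebra_simps)
    moreover have "d \<tau> = (u \<tau> - T \<tau> x) - (v \<tau> - T \<tau> x)" by (simp add: d_def)
    ultimately show ?thesis by (simp add: conv_def)
  qed
  obtain K where K: "K > 0" "\<And>r. r \<in> {0..N} \<Longrightarrow> norm (\<beta> r) \<le> K"
    using compact_norm_bound[OF compact_Icc \<beta>] by blast
  obtain J where J: "J > 0" "\<And>r. r \<in> {0..N} \<Longrightarrow> norm (E r) \<le> J"
    using compact_norm_bound[OF compact_Icc E] by blast
  define C where "C = max 0 M * exp (\<bar>\<omega>\<bar> * N)"
  have C: "C \<ge> 0" by (simp add: C_def)
  \<comment> \<open>The equations for \<open>d\<close> and \<open>e\<close> are coupled, so the
    Gronwall inequality is applied to the sum; \<open>L\<close> adds up the two Lipschitz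
    constants.\<close>
  define q where "q = (\<lambda>\<tau>. norm (d \<tau>) + norm (e \<tau>))"
  define L where "L = C * (K + 1) + J * (\<bar>\<mu>\<bar> + K + 1)"
  have L: "L \<ge> 0" using C K J by (simp add: L_def)
  have "q \<tau> \<le> 0" if "\<tau> \<in> {0..N}" for \<tau>
  proof (rule gronwall_zero[OF _ _ L that])
    show "continuous_on {0..N} q" unfolding q_def by (intro continuous_intros d e)
    fix \<tau> assume \<tau>: "\<tau> \<in> {0..N}"
    have sub: "continuous_on {0..\<tau>} d" "continuous_on {0..\<tau>} e"
      using \<tau> by (auto intro: continuous_on_subset[OF d] continuous_on_subset[OF e])
    have q: "continuous_on {0..\<tau>} q" unfolding q_def by (intro continuous_intros sub)
    have b\<beta>: "norm (\<beta> r (d r)) \<le> K * norm (d r)" if "r \<in> {0..\<tau>}" for r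
    proof -
      have "norm (\<beta> r) \<le> K" using that \<tau> by (intro K) auto
      then show ?thesis by (meson norm_blinfun mult_right_mono norm_ge_zero order_trans)
    qed
    have "norm (d \<tau>) \<le> C * integral {0..\<tau>} (\<lambda>r. norm (\<beta> r (d r) - e r))"
      unfolding d_int[OF \<tau>] unfolding conv_def C_def
      by (rule conv_norm_le) (use \<tau> in \<open>auto intro!: continuous_intros \<beta> sub\<close>)
    also have "\<dots> \<le> C * integral {0..\<tau>} (\<lambda>r. (K + 1) * q r)"
    proof (rule mult_left_mono[OF integral_le C])
      fix r assume r: "r \<in> {0..\<tau>}"
      have "norm (\<beta> r (d r) - e r) \<le> norm (\<beta> r (d r)) + norm (e r)" by (rule norm_triangle_ineq4)
      also have "\<dots> \<le> K * norm (d r) + norm (e r)" using b\<beta>[OF r] by simp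
      also have "\<dots> \<le> (K + 1) * q r" using K by (simp add: q_def algebra_simps)
      finally show "norm (\<beta> r (d r) - e r) \<le> (K + 1) * q r" .
    qed (intro integrable_continuous_real continuous_intros \<beta> sub q)+
    finally have 1: "norm (d \<tau>) \<le> C * ((K + 1) * integral {0..\<tau>} q)" by simp
    have "norm (e \<tau>) \<le> integral {0..\<tau>} (\<lambda>r. J * ((\<bar>\<mu>\<bar> + K + 1) * q r))"
      unfolding e_int[OF \<tau>]
    proof (rule integral_norm_bound_integral)
      fix r assume r: "r \<in> {0..\<tau>}"
      have "norm (\<mu> *\<^sub>R d r + \<beta> r (d r) - e r) \<le> norm (\<mu> *\<^sub>R d r) + norm (\<beta> r (d r)) + norm (e r)"
        by (meson norm_triangle_ineq4 norm_triangle_ineq add_right_mono order_trans)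
      also have "\<dots> \<le> \<bar>\<mu>\<bar> * norm (d r) + K * norm (d r) + norm (e r)" using b\<beta>[OF r] by simp
      also have "\<dots> \<le> (\<bar>\<mu>\<bar> + K + 1) * q r" using K by (simp add: q_def algebra_simps add_nonneg_nonneg)
      finally have le: "norm (\<mu> *\<^sub>R d r + \<beta> r (d r) - e r) \<le> (\<bar>\<mu>\<bar> + K + 1) * q r" .
      have "norm (E r (\<mu> *\<^sub>R d r + \<beta> r (d r) - e r)) \<le> norm (E r) * norm (\<mu> *\<^sub>R d r + \<beta> r (d r) - e r)"
        by (rule norm_blinfun)
      also have "\<dots> \<le> J * ((\<bar>\<mu>\<bar> + K + 1) * q r)"
        using r \<tau> J by (intro mult_mono le) auto
      finally show "norm (E r (\<mu> *\<^sub>R d r + \<beta> r (d r) - e r)) \<le> J * ((\<bar>\<mu>\<bar> + K + 1) * q r)" .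
    qed (intro integrable_continuous_real continuous_intros E \<beta> sub q)+
    then have 2: "norm (e \<tau>) \<le> J * ((\<bar>\<mu>\<bar> + K + 1) * integral {0..\<tau>} q)" by simp
    show "q \<tau> \<le> L * integral {0..\<tau>} q" using add_mono[OF 1 2] by (simp add: q_def[of] L_def algebra_simps)
  qed
  then have uv: "u \<tau> = v \<tau>" if "\<tau> \<in> {0..N}" for \<tau>
    using that unfolding q_def d_def
    by (metis add_nonneg_eq_0_iff antisym eq_iff_diff_eq_0 norm_eq_zero norm_ge_zero add_nonneg_nonneg)
  show ?thesis
  proof (rule that)
    show "f 0 = y + P s x" by (simp add: f_0 f0_def \<beta>_def)
    fix \<tau> assume \<tau>: "\<tau> \<in> {0..N}"
    show "((\<lambda>\<tau>. evol P s \<tau> x) has_vector_derivative f \<tau>) (at \<tau> within {0..N})"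
      by (rule has_vector_derivative_transform[OF \<tau> _ v'[OF \<tau>]]) (use uv in \<open>simp add: u_def\<close>)
  qed
qed

end

section \<open>Extension to bounded operators\<close>

lemma dense_eq:
  fixes f g :: "'a::t2_space \<Rightarrow> 'b::t2_space"
  assumes "closure D = UNIV" "continuous_on UNIV f" "continuous_on UNIV g" "\<And>x. x \<in> D \<Longrightarrow> f x = g x"
  shows "f x = g x"
proof -
  have "closure D \<subseteq> {x. f x = g x}"
    using assms by (intro closure_minimal closed_Collect_eq) auto
  then show ?thesis using assms(1) by auto
qed

lemma dense_norm_le:
  fixes F :: "'a::real_normed_vector \<Rightarrow>\<^sub>L 'b::real_normed_vector"
  assumes D: "closure D = UNIV" and le: "\<And>x. x \<in> D \<Longrightarrow> norm (F x) \<le> K * norm x" and K: "K \<ge> 0"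
  shows "norm F \<le> K"
proof (rule norm_blinfun_bound[OF K])
  have "closure D \<subseteq> {x. norm (F x) \<le> K * norm x}"
    using le by (intro closure_minimal closed_Collect_le continuous_intros) auto
  then show "norm (F x) \<le> K * norm x" for x using D by auto
qed

text \<open>On \<open>D\<close> the map is Lipschitz, so it extends to the closure. Additivity is
  transferred by density in one argument at a time, the norm bound by closedness.\<close>

lemma extend_from_dense:
  fixes f :: "'a::real_normed_vector \<Rightarrow> 'b::banach"
  assumes D: "closure D = UNIV"
    and closed: "\<And>x y. x \<in> D \<Longrightarrow> y \<in> D \<Longrightarrow> x + y \<in> D" "\<And>r x. x \<in> D \<Longrightarrow> r *\<^sub>R x \<in> D"
    and lin: "\<And>x y. x \<in> D \<Longrightarrow> y \<in> D \<Longrightarrow> f (x + y) = f x + f y"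
      "\<And>r x. x \<in> D \<Longrightarrow> f (r *\<^sub>R x) = r *\<^sub>R f x"
    and bd: "\<And>x. x \<in> D \<Longrightarrow> norm (f x) \<le> K * norm x"
  obtains F :: "'a \<Rightarrow>\<^sub>L 'b" where "\<And>x. x \<in> D \<Longrightarrow> F x = f x"
proof -
  have lip: "norm (f x - f y) \<le> \<bar>K\<bar> * norm (x - y)" if "x \<in> D" "y \<in> D" for x y
  proof -
    have "f (x + (- 1) *\<^sub>R y) = f x + (- 1) *\<^sub>R f y"
      using lin(1)[OF that(1) closed(2)[OF that(2)]] lin(2)[OF that(2)] by (simp only:)
    then have "norm (f x - f y) = norm (f (x + (- 1) *\<^sub>R y))" by simp
    also have "\<dots> \<le> K * norm (x + (- 1) *\<^sub>R y)" using that by (intro bd closed)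
    also have "\<dots> \<le> \<bar>K\<bar> * norm (x - y)" by (simp add: mult_right_mono)
    finally show ?thesis .
  qed
  have "\<bar>K\<bar>-lipschitz_on D f" using lip by (auto simp: lipschitz_on_def dist_norm)
  then have "uniformly_continuous_on D f" by (rule lipschitz_on_uniformly_continuous)
  then obtain g where "uniformly_continuous_on (closure D) g" and gf: "\<And>x. x \<in> D \<Longrightarrow> f x = g x"
    by (rule uniformly_continuous_on_extension_on_closure) blast
  then have g: "continuous_on UNIV g"
    using D uniformly_continuous_imp_continuous by force
  note gc [continuous_intros] = continuous_on_compose2[OF g]
  have add1: "g (x + y) = g x + g y" if "y \<in> D" for x y
    by (rule dense_eq[OF D, where f = "\<lambda>x. g (x + y)"])
       (use that closed lin in \<open>auto intro!: continuous_intros simp flip: gf\<close>)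
  have "g (x + y) = g x + g y" for x y
    by (rule dense_eq[OF D, where f = "\<lambda>y. g (x + y)"]) (use add1 in \<open>auto intro!: continuous_intros\<close>)
  moreover have "g (r *\<^sub>R x) = r *\<^sub>R g x" for r x
    by (rule dense_eq[OF D, where f = "\<lambda>x. g (r *\<^sub>R x)"])
       (use closed lin in \<open>auto intro!: continuous_intros simp flip: gf\<close>)
  moreover have "norm (g x) \<le> norm x * K" for x
  proof -
    have "closure D \<subseteq> {x. norm (g x) \<le> K * norm x}"
      using bd gf g by (intro closure_minimal closed_Collect_le continuous_intros) auto
    then show ?thesis using D by (auto simp: mult.commute)
  qed
  ultimately have "bounded_linear g" by (rule bounded_linear_intro)
  then have "Blinfun g x = f x" if "x \<in> D" for x using gf[OF that] by (simp add: bounded_linear_Blinfun_apply)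
  then show ?thesis by (rule that)
qed

lemma banach_space_over_bounded_linear:
  assumes "banach_space_over scl"
  shows "bounded_linear (scl c)"
proof -
  interpret module scl using assms by (simp add: banach_space_over_def)
  have real: "scl (of_real r) x = r *\<^sub>R x" and norm: "norm (scl c x) = norm c * norm x" for r c x
    using assms by (auto simp: banach_space_over_def)
  show ?thesis
  proof (rule bounded_linear_intro)
    show "scl c (r *\<^sub>R x) = r *\<^sub>R scl c x" for r x
      using scale_left_commute[of c "of_real r" x] by (simp only: real)
    show "norm (scl c x) \<le> norm x * norm c" for x by (simp add: norm mult.commute)
  qed (rule scale_right_distrib)
qed

text \<open>\<open>Blinfun\<close> is meaningful only on maps known to be bounded; agreement with an
  existing operator settles boundedness and value at once.\<close>

lemma Blinfun_of_pointwise_eq: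
  assumes "\<And>x. f x = blinfun_apply F x"
  shows "bounded_linear f" "Blinfun f = F"
proof -
  have "f = blinfun_apply F" using assms by auto
  then show "bounded_linear f" "Blinfun f = F" by (simp_all add: blinfun.bounded_linear_right blinfun_apply_inverse)
qed

section \<open>Resolvent bounds as operator bounds\<close>

context strongly_continuous_semigroup
begin

lemma gen_iff_generator: "gen x y \<longleftrightarrow> generator T x = Some y"
proof
  show "gen x y \<Longrightarrow> generator T x = Some y"
    unfolding gen_def generator_def using tendsto_Lim[OF trivial_limit_at_right_real] by auto
  assume *: "generator T x = Some y"
  then obtain z where z: "gen x z" unfolding gen_def generator_def by (auto split: if_splits)
  then have "generator T x = Some z"
    unfolding gen_def generator_def using tendsto_Lim[OF trivial_limit_at_right_real] by auto
  with * z show "gen x y" by simp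
qed

lemma gen_generator: "x \<in> dom (generator T) \<Longrightarrow> gen x (the (generator T x))"
  by (auto simp: gen_iff_generator)

lemma is_resolvent_resolvent:
  assumes "\<mu> > \<omega>"
  shows "is_resolvent \<mu> (resolvent \<mu> (generator T))"
proof -
  obtain R where R: "is_resolvent \<mu> R" using resolvent_exists[OF assms] by blast
  have "inv_into (dom (generator T)) (\<lambda>x. \<mu> *\<^sub>R x - the (generator T x)) z = R z" for z
  proof (rule inv_into_f_eq)
    show "inj_on (\<lambda>x. \<mu> *\<^sub>R x - the (generator T x)) (dom (generator T))"
      using R gen_generator unfolding is_resolvent_def by (intro inj_on_inverseI[where g = R]) blast
    show "R z \<in> dom (generator T)" "\<mu> *\<^sub>R R z - the (generator T (R z)) = z"
      using R by (auto simp: is_resolvent_def gen_iff_generator)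
  qed
  then have "resolvent \<mu> (generator T) = R" unfolding resolvent_def by (rule Blinfun_of_pointwise_eq)
  with R show ?thesis by simp
qed

lemma resolvent_dom: "\<mu> > \<omega> \<Longrightarrow> resolvent \<mu> (generator T) x \<in> dom (generator T)"
  using is_resolvent_resolvent by (auto simp: is_resolvent_def gen_iff_generator)

lemma dom_generator_dense: "closure (dom (generator T)) = UNIV"
proof -
  have "dom (generator T) = {x. \<exists>y. gen x y}" by (auto simp: gen_iff_generator)
  then show ?thesis using gen_dense by simp
qed

text \<open>Write \<open>C x = C R(\<mu>, A) (\<mu> x - A x)\<close> and let \<open>\<mu> \<rightarrow> \<infinity>\<close>.\<close>

lemma resolvent_bound_imp_bounded:
  assumes lin: "\<And>\<mu>. \<mu> > \<omega> \<Longrightarrow> bounded_linear (\<lambda>x. the (C (resolvent \<mu> (generator T) x)))"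
    and bd: "\<And>\<mu>. \<mu> > \<omega> \<Longrightarrow> norm ((\<mu> - \<omega>) *\<^sub>R op_resolvent C \<mu> (generator T)) \<le> S"
    and x: "x \<in> dom (generator T)"
  shows "norm (the (C x)) \<le> S * norm x"
proof -
  define y where "y = the (generator T x)"
  have S: "S \<ge> 0" by (rule order_trans[OF norm_ge_zero bd[of "\<omega> + 1"]]) simp
  have le: "norm (the (C x)) \<le> S * norm x + S * norm (\<omega> *\<^sub>R x - y) / real n" if n: "n \<ge> 1" for n :: nat
  proof -
    \<comment> \<open>The weight is then exactly \<open>n\<close> and \<mu> x - y = n x + (\<omega>
      x - y), so division by \<open>n\<close> leaves an error of order 1/n.\<close>
    define \<mu> where "\<mu> = \<omega> + real n"
    have \<mu>: "\<mu> > \<omega>" and \<mu>n: "\<mu> - \<omega> = real n" using n by (auto simp: \<mu>_def)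
    have "resolvent \<mu> (generator T) (\<mu> *\<^sub>R x - y) = x"
      using is_resolvent_resolvent[OF \<mu>] gen_generator[OF x] by (simp add: is_resolvent_def y_def)
    then have "the (C x) = op_resolvent C \<mu> (generator T) (\<mu> *\<^sub>R x - y)"
      by (simp add: op_resolvent_def bounded_linear_Blinfun_apply[OF lin[OF \<mu>]])
    then have "real n * norm (the (C x)) = norm (((\<mu> - \<omega>) *\<^sub>R op_resolvent C \<mu> (generator T)) (\<mu> *\<^sub>R x - y))"
      by (simp add: blinfun.scaleR_left \<mu>n)
    also have "\<dots> \<le> S * norm (\<mu> *\<^sub>R x - y)"
      by (meson norm_blinfun bd[OF \<mu>] mult_right_mono norm_ge_zero order_trans)
    also have "\<mu> *\<^sub>R x - y = real n *\<^sub>R x + (\<omega> *\<^sub>R x - y)" by (simp add: \<mu>_def algebra_simps)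
    also have "S * norm \<dots> \<le> S * (real n * norm x + norm (\<omega> *\<^sub>R x - y))"
      using S norm_triangle_ineq[of "real n *\<^sub>R x"] by (intro mult_left_mono) auto
    finally show ?thesis using n by (simp add: field_simps)
  qed
  have "(\<lambda>n. S * norm x + S * norm (\<omega> *\<^sub>R x - y) / real n) \<longlonglongrightarrow> S * norm x + 0"
    by (intro tendsto_intros lim_const_over_n)
  then show ?thesis using LIMSEQ_le_const[of _ "S * norm x" "norm (the (C x))"] le by auto
qed

lemma GL_bounded:
  assumes C: "C \<in> GL scl (generator T) \<omega>" and x: "x \<in> dom (generator T)"
  shows "norm (the (C x)) \<le> (SUP \<mu>\<in>{\<omega><..}. norm ((\<mu> - \<omega>) *\<^sub>R op_resolvent C \<mu> (generator T))) * norm x"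
  using C by (intro resolvent_bound_imp_bounded[OF _ _ x]) (auto simp: GL_def intro!: cSUP_upper)

text \<open>Turns continuity with respect to \<open>GL_norm\<close> into operator norm continuity of
  the bounded extensions.\<close>

lemma GL_norm_op_diff_bound:
  assumes C: "C \<in> GL scl (generator T) \<omega>" and C': "C' \<in> GL scl (generator T) \<omega>"
    and x: "x \<in> dom (generator T)"
  shows "norm (the (C x) - the (C' x)) \<le> M * GL_norm (generator T) M \<omega> (op_diff C C') * norm x"
proof -
  let ?A = "generator T"
  let ?n = "\<lambda>C \<mu>. norm ((\<mu> - \<omega>) *\<^sub>R op_resolvent C \<mu> ?A)"
  have dC: "dom C = dom ?A" and dC': "dom C' = dom ?A" using C C' by (auto simp: GL_def)
  have val: "the (op_diff C C' x) = the (C x) - the (C' x)" if "x \<in> dom ?A" for x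
    using that by (simp add: op_diff_def dC dC')
  have lin: "bounded_linear (\<lambda>x. the (C (resolvent \<mu> ?A x)))" "bounded_linear (\<lambda>x. the (C' (resolvent \<mu> ?A x)))"
    if "\<mu> > \<omega>" for \<mu>
    using C C' that by (auto simp: GL_def)
  have "the (op_diff C C' (resolvent \<mu> ?A x)) = (op_resolvent C \<mu> ?A - op_resolvent C' \<mu> ?A) x" if "\<mu> > \<omega>" for \<mu> x
    by (simp add: val resolvent_dom that op_resolvent_def bounded_linear_Blinfun_apply lin blinfun.diff_left)
  note diff = Blinfun_of_pointwise_eq[OF this]
  have res: "op_resolvent (op_diff C C') \<mu> ?A = op_resolvent C \<mu> ?A - op_resolvent C' \<mu> ?A" if "\<mu> > \<omega>" for \<mu>
    using diff(2)[OF that] by (simp add: op_resolvent_def)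
  \<comment> \<open>A real supremum says nothing about an unbounded set, so the bound for the
    difference comes first.\<close>
  have bdd: "bdd_above (?n (op_diff C C') ` {\<omega><..})"
  proof -
    obtain b b' where b: "\<And>\<mu>. \<mu> > \<omega> \<Longrightarrow> ?n C \<mu> \<le> b" "\<And>\<mu>. \<mu> > \<omega> \<Longrightarrow> ?n C' \<mu> \<le> b'"
      using C C' unfolding GL_def bdd_above_def by fastforce
    show ?thesis
    proof (rule bdd_aboveI2)
      fix \<mu> assume "\<mu> \<in> {\<omega><..}"
      then have \<mu>: "\<mu> > \<omega>" by simp
      have "?n (op_diff C C') \<mu> \<le> ?n C \<mu> + ?n C' \<mu>"
        unfolding res[OF \<mu>] scaleR_diff_right by (rule norm_triangle_ineq4)
      then show "?n (op_diff C C') \<mu> \<le> b + b'" using b[OF \<mu>] by linarith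
    qed
  qed
  have "norm (the (op_diff C C' x)) \<le> (SUP \<mu>\<in>{\<omega><..}. ?n (op_diff C C') \<mu>) * norm x"
    using diff(1) bdd by (intro resolvent_bound_imp_bounded[OF _ _ x]) (auto intro!: cSUP_upper)
  then have le: "norm (the (C x) - the (C' x)) \<le> (SUP \<mu>\<in>{\<omega><..}. ?n (op_diff C C') \<mu>) * norm x"
    by (simp add: val[OF x])
  show ?thesis
  \<comment> \<open>The factor \<open>M\<close> undoes \<open>1 / M\<close> in the norm, except for
    \<open>M = 0\<close>, where \<open>1 / M\<close> is \<open>0\<close>. Then the identity has norm
    at most \<open>0\<close> and the space is trivial.\<close>
  proof (cases "M = 0")
    case True
    then have "norm (T 0) \<le> 0" using T_bound[of 0] by simp
    then have "z = 0" for z :: 'a using T_0 by (metis blinfun_apply_id_blinfun norm_le_zero_iff zero_blinfun.rep_eq)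
    then show ?thesis by (metis norm_zero mult_zero_right order_refl)
  qed (use le in \<open>simp add: GL_norm_def\<close>)
qed

end

lemma module_subspace_scaleR:
  assumes "banach_space_over scl" "module.subspace scl D"
  shows "x \<in> D \<Longrightarrow> y \<in> D \<Longrightarrow> x + y \<in> D" "x \<in> D \<Longrightarrow> r *\<^sub>R x \<in> D"
proof -
  interpret module scl using assms by (simp add: banach_space_over_def)
  have real: "scl (of_real r) x = r *\<^sub>R x" for r x using assms by (simp add: banach_space_over_def)
  show "x \<in> D \<Longrightarrow> y \<in> D \<Longrightarrow> x + y \<in> D" using subspace_add[OF assms(2)] .
  show "x \<in> D \<Longrightarrow> r *\<^sub>R x \<in> D" using subspace_scale[OF assms(2), of x "of_real r"] by (simp add: real)
qed

theorem theorem4p3: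
  fixes scl :: "'k::real_normed_field \<Rightarrow> 'a::banach \<Rightarrow> 'a"
    and T :: "real \<Rightarrow> 'a \<Rightarrow>\<^sub>L 'a"
    and A :: "'a \<rightharpoonup> 'a"
    and B :: "real \<Rightarrow> 'a \<rightharpoonup> 'a"
    and M \<omega>\<^sub>0 :: real
  assumes "banach_space_over scl"
    and "c0_semigroup scl T"
    and "A = generator T"
    and "\<And>t. t \<ge> 0 \<Longrightarrow> norm (T t) \<le> M * exp (\<omega>\<^sub>0 * t)"
    and "\<And>t. linear_operator scl (B t) \<and> dom (B t) = dom A"
    and "\<And>a b. a < b \<Longrightarrow> GL_continuous_on scl A M \<omega>\<^sub>0 {a..b} B"
    and "\<And>a b \<mu>. a < b \<Longrightarrow> \<mu> > \<omega>\<^sub>0 \<Longrightarrow> C1_within {a..b} (\<lambda>t. op_resolvent (B t) \<mu> A)"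
    and "\<And>a b. a < b \<Longrightarrow>
           Limsup at_top (\<lambda>\<mu>::real. SUP t\<in>{a..b}.
             ereal (norm (vector_derivative (\<lambda>s. op_resolvent (B s) \<mu> A) (at t within {a..b})))) < \<infinity>"
  shows "admits_evolution_family scl (dom A) (\<lambda>t. op_add A (B t))"
proof -
  interpret strongly_continuous_semigroup T M \<omega>\<^sub>0
    using assms(2,4) by unfold_locales (auto simp: c0_semigroup_def)
  have domB: "dom (B t) = dom A" and linB: "linear_operator scl (B t)" for t using assms(5) by auto
  have dense: "closure (dom A) = UNIV" using dom_generator_dense assms(3) by simp
  note scl = banach_space_over_bounded_linear[OF assms(1)]
  have scl_real: "scl (of_real r) x = r *\<^sub>R x" for r x using assms(1) by (simp add: banach_space_over_def)
  have sub: "module.subspace scl (dom A)" using linB domB by (auto simp: linear_operator_def)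
  note sub_real = module_subspace_scaleR[OF assms(1) sub]
  have sub_scl: "scl c x \<in> dom A" if "x \<in> dom A" for c x
    using sub that assms(1) module.subspace_scale unfolding banach_space_over_def by blast
  have GLB: "B t \<in> GL scl (generator T) \<omega>\<^sub>0" for t
    using assms(6)[of t "t + 1"] assms(3) by (auto simp: GL_continuous_on_def)
  have "\<exists>F :: 'a \<Rightarrow>\<^sub>L 'a. \<forall>x \<in> dom A. F x = the (B t x)" for t
  proof -
    obtain F :: "'a \<Rightarrow>\<^sub>L 'a" where "\<And>x. x \<in> dom A \<Longrightarrow> F x = the (B t x)"
    proof (rule extend_from_dense[OF dense sub_real])
      show "x \<in> dom A \<Longrightarrow> y \<in> dom A \<Longrightarrow> the (B t (x + y)) = the (B t x) + the (B t y)" for x y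
        using linB[of t] domB[of t] by (auto simp: linear_operator_def)
      have "the (B t (scl (of_real r) x)) = scl (of_real r) (the (B t x))" if "x \<in> dom A" for r x
        using linB[of t] domB[of t] that unfolding linear_operator_def by blast
      then show "x \<in> dom A \<Longrightarrow> the (B t (r *\<^sub>R x)) = r *\<^sub>R the (B t x)" for r x
        by (simp add: scl_real)
    qed (use GL_bounded[OF GLB[of t]] assms(3) in auto)
    then show ?thesis by blast
  qed
  then obtain \<beta> :: "real \<Rightarrow> 'a \<Rightarrow>\<^sub>L 'a" where \<beta>: "\<And>t x. x \<in> dom A \<Longrightarrow> \<beta> t x = the (B t x)" by metis
  \<comment> \<open>The extension was built as a real-linear operator; compatibility with the
    scalars passes from the dense domain to the whole space.\<close>
  have \<beta>_scl: "\<beta> t (scl c x) = scl c (\<beta> t x)" for t c x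
  proof (rule dense_eq[OF dense, where f = "\<lambda>x. \<beta> t (scl c x)"])
    show "continuous_on UNIV (\<lambda>x. \<beta> t (scl c x))" "continuous_on UNIV (\<lambda>x. scl c (\<beta> t x))"
      by (intro continuous_intros bounded_linear.continuous_on[OF scl])+
    show "\<beta> t (scl c x) = scl c (\<beta> t x)" if "x \<in> dom A" for x
      using linB[of t] domB[of t] that by (simp add: \<beta> sub_scl linear_operator_def)
  qed
  have \<beta>_cont: "continuous_on UNIV \<beta>"
    unfolding continuous_on_eq_continuous_at[OF open_UNIV] continuous_at
  proof
    fix t :: real
    have int: "at t within {t - 1..t + 1} = at t" by (simp add: at_within_Icc_at)
    have "((\<lambda>s. GL_norm A M \<omega>\<^sub>0 (op_diff (B s) (B t))) \<longlongrightarrow> 0) (at t)"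
      using assms(6)[of "t - 1" "t + 1"] by (auto simp: GL_continuous_on_def int dest!: bspec[of _ _ t])
    then have "((\<lambda>s. \<bar>M * GL_norm A M \<omega>\<^sub>0 (op_diff (B s) (B t))\<bar>) \<longlongrightarrow> 0) (at t)"
      by (intro tendsto_rabs_zero tendsto_mult_right_zero)
    then show "(\<beta> \<longlongrightarrow> \<beta> t) (at t)"
    proof (rule Lim_null_comparison[THEN Lim_null[THEN iffD2], rotated], intro always_eventually allI)
      fix s
      show "norm (\<beta> s - \<beta> t) \<le> \<bar>M * GL_norm A M \<omega>\<^sub>0 (op_diff (B s) (B t))\<bar>"
      proof (rule dense_norm_le[OF dense])
        fix x assume x: "x \<in> dom A"
        then have "norm (the (B s x) - the (B t x)) \<le> M * GL_norm A M \<omega>\<^sub>0 (op_diff (B s) (B t)) * norm x"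
          using GL_norm_op_diff_bound[OF GLB GLB] assms(3) by simp
        also have "\<dots> \<le> \<bar>M * GL_norm A M \<omega>\<^sub>0 (op_diff (B s) (B t))\<bar> * norm x"
          by (intro mult_right_mono) auto
        finally show "norm ((\<beta> s - \<beta> t) x) \<le> \<bar>M * GL_norm A M \<omega>\<^sub>0 (op_diff (B s) (B t))\<bar> * norm x"
          by (simp add: blinfun.diff_left \<beta> x)
      qed simp
    qed
  qed
  define \<mu> where "\<mu> = \<omega>\<^sub>0 + 1"
  define R where "R = resolvent \<mu> A"
  have \<mu>: "\<mu> > \<omega>\<^sub>0" by (simp add: \<mu>_def)
  have R: "is_resolvent \<mu> R" using is_resolvent_resolvent[OF \<mu>] by (simp add: R_def assms(3))
  have "the (B t (resolvent \<mu> A x)) = (\<beta> t o\<^sub>L R) x" for t x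
    using resolvent_dom[OF \<mu>] by (simp add: R_def assms(3) \<beta>)
  then have res\<beta>: "op_resolvent (B t) \<mu> A = \<beta> t o\<^sub>L R" for t
    unfolding op_resolvent_def by (rule Blinfun_of_pointwise_eq)
  have C1: "C1_within {a..b} (\<lambda>t. \<beta> t o\<^sub>L R)" if "a < b" for a b
    using assms(7)[OF that \<mu>] by (simp add: res\<beta>)
  have A_val: "gen x (the (A x))" "the (op_add A (B t) x) = the (A x) + \<beta> t x" if "x \<in> dom A" for x t
    using that gen_generator assms(3) domB by (auto simp: op_add_def \<beta>)
  define U where "U = (\<lambda>t s. evol \<beta> s (t - s))"
  have right: "\<exists>f. f s = the (op_add A (B s) x) \<and>
      (\<forall>\<tau>\<in>{s..b}. ((\<lambda>\<tau>. U \<tau> s x) has_vector_derivative f \<tau>) (at \<tau> within {s..b}))"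
    if x: "x \<in> dom A" and "s \<le> b" for x s b
  proof -
    \<comment> \<open>The surplus \<open>1\<close> gives the interval positive length even for
      \<open>s = b\<close>, as the differentiability assumption demands; the derivative is
      restricted to \<open>{s..b}\<close> afterwards.\<close>
    define N where "N = b - s + 1"
    have N: "N > 0" using that by (simp add: N_def)
    define D where "D = (\<lambda>t. vector_derivative (\<lambda>t. \<beta> t o\<^sub>L R) (at t within {s..s + N}))"
    have D: "continuous_on {s..s + N} D" using C1[of s "s + N"] N by (simp add: C1_within_def D_def)
    have QD: "((\<lambda>t. \<beta> t o\<^sub>L R) has_vector_derivative D t) (at t within {s..s + N})" if "t \<in> {s..s + N}" for t
      using C1[of s "s + N"] N that by (simp add: C1_within_def D_def vector_derivative_works)
    have im: "(\<lambda>r. s + r) ` {0..N} = {s..s + N}" by simp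
    obtain f where f: "f 0 = the (A x) + \<beta> s x"
      "\<And>\<tau>. \<tau> \<in> {0..N} \<Longrightarrow> ((\<lambda>\<tau>. evol \<beta> s \<tau> x) has_vector_derivative f \<tau>) (at \<tau> within {0..N})"
    proof (rule evol_final_time_derivative[OF \<beta>_cont R, of N "\<lambda>r. D (s + r)" s x "the (A x)"])
      show "continuous_on {0..N} (\<lambda>r. D (s + r))"
        by (rule continuous_on_compose2[OF D]) (auto intro!: continuous_intros)
      fix r assume r: "r \<in> {0..N}"
      have "((\<lambda>t. \<beta> t o\<^sub>L R) \<circ> (\<lambda>r. s + r) has_vector_derivative 1 *\<^sub>R D (s + r)) (at r within {0..N})"
      proof (rule vector_diff_chain_within)
        show "((\<lambda>r. s + r) has_vector_derivative 1) (at r within {0..N})"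
          by (auto intro!: derivative_eq_intros)
        show "((\<lambda>t. \<beta> t o\<^sub>L R) has_vector_derivative D (s + r)) (at (s + r) within (\<lambda>r. s + r) ` {0..N})"
          unfolding im using r by (intro QD) auto
      qed
      then show "((\<lambda>r. \<beta> (s + r) o\<^sub>L R) has_vector_derivative D (s + r)) (at r within {0..N})"
        by (simp add: o_def)
    qed (use N A_val(1)[OF x] in auto)
    have "((\<lambda>\<tau>. U \<tau> s x) has_vector_derivative f (\<tau> - s)) (at \<tau> within {s..b})" if \<tau>: "\<tau> \<in> {s..b}" for \<tau>
    proof -
      have "((\<lambda>\<tau>. evol \<beta> s \<tau> x) \<circ> (\<lambda>\<tau>. \<tau> - s) has_vector_derivative 1 *\<^sub>R f (\<tau> - s)) (at \<tau> within {s..b})"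
      proof (rule vector_diff_chain_within)
        show "((\<lambda>\<tau>. \<tau> - s) has_vector_derivative 1) (at \<tau> within {s..b})"
          by (auto intro!: derivative_eq_intros)
        show "((\<lambda>\<tau>. evol \<beta> s \<tau> x) has_vector_derivative f (\<tau> - s)) (at (\<tau> - s) within (\<lambda>\<tau>. \<tau> - s) ` {s..b})"
          by (rule has_vector_derivative_within_subset[OF f(2)]) (use \<tau> in \<open>auto simp: N_def\<close>)
      qed
      then show ?thesis by (simp add: o_def U_def)
    qed
    then show ?thesis using f(1) A_val(2)[OF x] by (intro exI[of _ "\<lambda>\<tau>. f (\<tau> - s)"]) simp
  qed
  have "evolution_family_on scl a b (dom A) (\<lambda>t. op_add A (B t)) U" if ab: "a \<le> b" for a b
    unfolding evolution_family_on_def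
  proof (intro conjI allI impI ballI)
    fix s t assume st: "a \<le> s \<and> s \<le> t \<and> t \<le> b"
    \<comment> \<open>Multiplication by \<open>c\<close> commutes with the semigroup and with
      \<open>\<beta>\<close>, hence with mild solutions.\<close>
    have "scl c (T \<tau> x) = T \<tau> (scl c x)" if "\<tau> \<ge> 0" for c \<tau> x
      using assms(2) that by (simp add: c0_semigroup_def blinfun_over_def)
    then show "blinfun_over scl (U t s)"
      using mild_commute[OF \<beta>_cont scl _ \<beta>_scl[symmetric]] st
      by (simp add: blinfun_over_def U_def evol_apply[OF \<beta>_cont])
  next
    show "continuous_on {(t, s). a \<le> s \<and> s \<le> t \<and> t \<le> b} (\<lambda>(t, s). U t s x)" for x
      unfolding U_def split_beta by (intro evol_cont[OF \<beta>_cont] continuous_intros)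
  next
    show "U t t = id_blinfun" for t by (simp add: U_def evol_0[OF \<beta>_cont])
  next
    fix r s t assume "a \<le> r \<and> r \<le> s \<and> s \<le> t \<and> t \<le> b"
    then show "U t s o\<^sub>L U s r = U t r"
      using evol_evol[OF \<beta>_cont, of "s - r" "t - s" r] by (intro blinfun_eqI) (simp add: U_def)
  next
    \<comment> \<open>Large enough for initial times and elapsed times alike. On a compact interval
      a constant bound suffices, so the growth exponent below is \<open>0\<close>.\<close>
    define N where "N = \<bar>a\<bar> + \<bar>b\<bar> + \<bar>b - a\<bar>"
    have "N \<ge> 0" by (simp add: N_def)
    then obtain C where C: "\<And>s \<tau>. \<bar>s\<bar> \<le> N \<Longrightarrow> \<tau> \<le> N \<Longrightarrow> norm (evol \<beta> s \<tau>) \<le> C"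
      using evol_bound[OF \<beta>_cont] by metis
    have "norm (U t s) \<le> C * exp (0 * (t - s))" if "a \<le> s \<and> s \<le> t \<and> t \<le> b" for s t
      using C[of s "t - s"] that by (auto simp: U_def N_def)
    then show "\<exists>M' \<omega>'. \<forall>s t. a \<le> s \<and> s \<le> t \<and> t \<le> b \<longrightarrow> norm (U t s) \<le> M' * exp (\<omega>' * (t - s))"
      by blast
  next
    fix x s t assume x: "x \<in> dom A" and st: "a \<le> s \<and> s \<le> t \<and> t \<le> b"
    then have "s \<le> b" by simp
    then show "(\<lambda>\<tau>. U \<tau> s x) differentiable (at t within {s..b})"
      using right[OF x \<open>s \<le> b\<close>] st differentiableI_vector by (metis atLeastAtMost_iff)
  next
    fix x s assume x: "x \<in> dom A" and s: "s \<in> {a..b}"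
    then show "((\<lambda>\<tau>. U \<tau> s x) has_vector_derivative the (op_add A (B s) x)) (at s within {s..b})"
      using right[OF x, of s b] by (metis atLeastAtMost_iff order_refl)
  next
    fix x s t assume x: "x \<in> dom A" and st: "a \<le> s \<and> s \<le> t \<and> t \<le> b"
    then show "((\<lambda>\<sigma>. U t \<sigma> x) has_vector_derivative - U t s (the (op_add A (B s) x))) (at s within {a..t})"
      using evol_initial_time_derivative[OF \<beta>_cont A_val(1)[OF x], of s a t] by (simp add: U_def A_val(2)[OF x])
  qed
  then show ?thesis unfolding admits_evolution_family_def by blast
qed

end
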